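(* Let $(c,\kappa)\in\tilde{\mathcal{D}}\cup\mathcal{C}$ and let $u\in\mathcal{X}(\mathbb{R})$ be a weak solution to $\mathrm{TW}(c,\kappa)$. If $c>0$, then $\inf_{\mathbb{R}}|u|>0$ (i.e. $u\in\mathcal{N}\mathcal{X}(\mathbb{R})$). If $c=0$, then there exists $\phi\in\mathbb{R}$ such that $e^{i\phi}u(x)\in\mathbb{R}$ for all $x\in\mathbb{R}$.
   Context: For $z_1,z_2\in\mathbb{C}$, $\langle z_1,z_2\rangle=\operatorname{Re}(z_1\overline{z_2})$. Energy space: $\mathcal{X}(\mathbb{R})=\{v\in H^1_{\mathrm{loc}}(\mathbb{R};\mathbb{C}): 1-|v|^2\in L^2(\mathbb{R}),\ v'\in L^2(\mathbb{R})\}$ (its elements are continuous); $\mathcal{N}\mathcal{X}(\mathbb{R})=\{v\in\mathcal{X}(\mathbb{R}):\inf_{\mathbb{R}}|v|>0\}$. $\mathrm{TW}(c,\kappa)$ is the equation $icu'+u''+u(1-|u|^2)+\kappa u(1-|u|^2)''=0$. A function $u\in\mathcal{X}(\mathbb{R})$ is a weak solution if for all $\phi\in C_0^\infty(\mathbb{R};\mathbb{C})$, $$\int_{\mathbb{R}}\langle icu'+u(1-|u|^2),\phi\rangle-\langle u',\phi'\rangle+2\kappa\langle u,u'\rangle\langle u,\phi\rangle'=0.$$ Parameter sets: $\tilde{\mathcal{D}}=\mathcal{D}_1\cup\mathcal{D}_3\cup\mathcal{B}_-\cup\mathcal{B}_+$ with $\mathcal{D}_1=\{0\le c<\sqrt2,\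 0<\kappa<1/2\}$, $\mathcal{D}_3=\{c>\sqrt2,\ \kappa>1/2\}$, $\mathcal{B}_-=\{c=\sqrt2,\ 0<\kappa<1/2\}$, $\mathcal{B}_+=\{c=\sqrt2,\ \kappa>1/2\}$; and $\mathcal{C}=\{c\ge0,\ \kappa=1/2\}$. *)

theory Defs
  imports "HOL-Analysis.Analysis"
begin

text \<open>The real inner product of two complex numbers is the library's \<open>inner\<close>.\<close>

lemma inner_complex_eq_Re: "inner z1 z2 = Re (z1 * cnj z2)" for z1 z2 :: complex
  by (simp add: inner_complex_def)

definition smooth :: "(real \<Rightarrow> 'a::euclidean_space) \<Rightarrow> bool" where
  "smooth f \<longleftrightarrow>
     (\<forall>n x. ((\<lambda>g t. vector_derivative g (at t)) ^^ n) f differentiable (at x))"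

definition test_functions :: "(real \<Rightarrow> 'a::euclidean_space) set" where
  "test_functions = {\<phi>. smooth \<phi> \<and> compact (closure {x. \<phi> x \<noteq> 0})}"

definition L2 :: "(real \<Rightarrow> 'a::euclidean_space) set" where
  "L2 = {f \<in> borel_measurable lborel. integrable lborel (\<lambda>x. (norm (f x))\<^sup>2)}"

definition L2_loc :: "(real \<Rightarrow> 'a::euclidean_space) set" where
  "L2_loc = {f \<in> borel_measurable lborel.
     \<forall>K. compact K \<longrightarrow> set_integrable lborel K (\<lambda>x. (norm (f x))\<^sup>2)}"

definition L1_loc :: "(real \<Rightarrow> 'a::euclidean_space) set" where
  "L1_loc = {f \<in> borel_measurable lborel.
     \<forall>K. compact K \<longrightarrow> set_integrable lborel K f}"

definition has_weak_derivative ::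
  "(real \<Rightarrow> 'a::euclidean_space) \<Rightarrow> (real \<Rightarrow> 'a) \<Rightarrow> bool" where
  "has_weak_derivative v w \<longleftrightarrow> v \<in> L1_loc \<and> w \<in> L1_loc \<and>
     (\<forall>\<psi> \<in> (test_functions :: (real \<Rightarrow> real) set).
        (LBINT x. vector_derivative \<psi> (at x) *\<^sub>R v x) = - (LBINT x. \<psi> x *\<^sub>R w x))"

text \<open>Weak derivatives are unique only up to null sets. The operator below picks a
  representative; it is only used under integrals and in \<open>L2\<close> membership, which do not
  depend on the choice.\<close>

definition weak_deriv :: "(real \<Rightarrow> 'a::euclidean_space) \<Rightarrow> real \<Rightarrow> 'a" where
  "weak_deriv v = (SOME w. has_weak_derivative v w)"

definition H1_loc :: "(real \<Rightarrow> 'a::euclidean_space) set" where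
  "H1_loc = {v \<in> L2_loc. \<exists>w \<in> L2_loc. has_weak_derivative v w}"

text \<open>An element of the energy space, a class of functions modulo null sets, is
  represented by its unique continuous member.\<close>

definition energy_space :: "(real \<Rightarrow> complex) set" where
  "energy_space = {v \<in> H1_loc. continuous_on UNIV v \<and>
     (\<lambda>x. 1 - (cmod (v x))\<^sup>2) \<in> L2 \<and> weak_deriv v \<in> L2}"

definition nonvanishing_energy_space :: "(real \<Rightarrow> complex) set" where
  "nonvanishing_energy_space = {v \<in> energy_space. (INF x. cmod (v x)) > 0}"

text \<open>The factor \<open>\<langle>u,\<phi>\<rangle>'\<close> is in general only a weak derivative, since \<open>u\<close> need not be
  differentiable; the derivative of \<open>\<phi>\<close> is the classical one.\<close>

definition weak_solution_TW :: "real \<Rightarrow> real \<Rightarrow> (real \<Rightarrow> complex) \<Rightarrow> bool" where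
  "weak_solution_TW c \<kappa> u \<longleftrightarrow> u \<in> energy_space \<and>
     (\<forall>\<phi> \<in> (test_functions :: (real \<Rightarrow> complex) set).
       (LBINT x.
          inner (\<i> * complex_of_real c * weak_deriv u x
                   + u x * complex_of_real (1 - (cmod (u x))\<^sup>2)) (\<phi> x)
          - inner (weak_deriv u x) (vector_derivative \<phi> (at x))
          + 2 * \<kappa> * inner (u x) (weak_deriv u x)
              * weak_deriv (\<lambda>t. inner (u t) (\<phi> t)) x) = 0)"

definition D1_set :: "(real \<times> real) set" where
  "D1_set = {(c, \<kappa>). 0 \<le> c \<and> c < sqrt 2 \<and> 0 < \<kappa> \<and> \<kappa> < 1/2}"

definition D3_set :: "(real \<times> real) set" where
  "D3_set = {(c, \<kappa>). c > sqrt 2 \<and> \<kappa> > 1/2}"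

definition B_minus_set :: "(real \<times> real) set" where
  "B_minus_set = {(c, \<kappa>). c = sqrt 2 \<and> 0 < \<kappa> \<and> \<kappa> < 1/2}"

definition B_plus_set :: "(real \<times> real) set" where
  "B_plus_set = {(c, \<kappa>). c = sqrt 2 \<and> \<kappa> > 1/2}"

definition D_tilde_set :: "(real \<times> real) set" where
  "D_tilde_set = D1_set \<union> D3_set \<union> B_minus_set \<union> B_plus_set"

definition C_set :: "(real \<times> real) set" where
  "C_set = {(c, \<kappa>). c \<ge> 0 \<and> \<kappa> = 1/2}"

end

theory Submission
  imports Defs "HOL-Computational_Algebra.Polynomial"
begin

text \<open>Write \<open>w = u'\<close>, \<open>\<eta> = 1 - \<bar>u\<bar>\<^sup>2\<close> and \<open>a = 2\<kappa>\<langle>u, w\<rangle>\<close>. Although \<open>u\<close> need not be twice differentiable where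
  \<open>2\<kappa>\<bar>u\<bar>\<^sup>2 = 1\<close>, the weak equation says that the flux \<open>F = w - a u\<close> is locally absolutely continuous
  with \<open>F' = - (i c w + \<eta> u + a w)\<close>. Differentiating \<open>\<langle>F, i u\<rangle>\<close> gives the momentum identity
  \<open>\<langle>w, i u\<rangle> = c \<eta> / 2\<close>, the constant of integration vanishing by integrability.

  If \<open>c > 0\<close>, this forces \<open>\<bar>w\<bar>\<close> to be at least a multiple of \<open>1 / \<bar>u\<bar>\<close> where \<open>\<bar>u\<bar>\<close> is small, while \<open>u\<close> is
  1/2-Hoelder continuous because \<open>w\<close> is square integrable; hence values of \<open>\<bar>u\<bar>\<close> near zero cost
  logarithmically diverging energy.

  If \<open>c = 0\<close> and \<open>n = i u(x\<^sub>1)\<close>, then \<open>v = \<langle>u, n\<rangle>\<close> and \<open>f = \<langle>F, n\<rangle>\<close> solve the linear system \<open>v' = f + a v\<close>,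
  \<open>f' = - \<eta> v - a f - a\<^sup>2 v\<close> with locally integrable coefficients, and both vanish at \<open>x\<^sub>1\<close> by the
  momentum identity; so \<open>v\<close> vanishes identically.\<close>

section \<open>Locally integrable functions\<close>

lemma L1_loc_iff_interval:
  "f \<in> L1_loc \<longleftrightarrow> f \<in> borel_measurable borel \<and> (\<forall>a b. set_integrable lborel {a..b} f)"
proof
  assume R: "f \<in> borel_measurable borel \<and> (\<forall>a b. set_integrable lborel {a..b} f)"
  have "set_integrable lborel K f" if "compact K" for K
  proof -
    obtain a b :: real where "K \<subseteq> {a..b}"
      using bounded_subset_cbox_symmetric compact_imp_bounded \<open>compact K\<close> by (metis interval_cbox)
    moreover have "K \<in> sets lborel" using borel_compact[OF \<open>compact K\<close>] by simp
    ultimately show ?thesis using R set_integrable_subset by blast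
  qed
  then show "f \<in> L1_loc" using R by (auto simp: L1_loc_def)
qed (auto simp: L1_loc_def)

lemma L1_loc_measurable: "f \<in> L1_loc \<Longrightarrow> f \<in> borel_measurable borel"
  by (simp add: L1_loc_iff_interval)

lemma L1_loc_set_integrable: "f \<in> L1_loc \<Longrightarrow> set_integrable lborel {a..b} f"
  by (simp add: L1_loc_iff_interval)

lemma L1_loc_integrable_on: "f \<in> L1_loc \<Longrightarrow> f integrable_on {a..b}"
  using set_borel_integral_eq_integral(1)[OF L1_loc_set_integrable] .

lemma L1_loc_bound:
  assumes f: "f \<in> borel_measurable borel" and g: "g \<in> L1_loc"
    and le: "\<And>x. norm (f x) \<le> norm (g x)"
  shows "f \<in> L1_loc"
proof -
  have "set_integrable lborel {a..b} f" for a b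
    unfolding set_integrable_def
  proof (rule Bochner_Integration.integrable_bound)
    show "integrable lborel (\<lambda>x. indicator {a..b} x *\<^sub>R g x)"
      using L1_loc_set_integrable[OF g] unfolding set_integrable_def .
    show "(\<lambda>x. indicator {a..b} x *\<^sub>R f x) \<in> borel_measurable lborel"
      using f by measurable
    show "AE x in lborel. norm (indicator {a..b} x *\<^sub>R f x) \<le> norm (indicator {a..b} x *\<^sub>R g x)"
      using le by (auto intro!: mult_left_mono)
  qed
  then show ?thesis using f by (simp add: L1_loc_iff_interval)
qed

lemma L1_loc_add: "f \<in> L1_loc \<Longrightarrow> g \<in> L1_loc \<Longrightarrow> (\<lambda>x. f x + g x) \<in> L1_loc"
  by (auto simp: L1_loc_iff_interval intro!: set_integral_add)

lemma L1_loc_diff: "f \<in> L1_loc \<Longrightarrow> g \<in> L1_loc \<Longrightarrow> (\<lambda>x. f x - g x) \<in> L1_loc"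
  by (auto simp: L1_loc_iff_interval intro!: set_integral_diff)

lemma L1_loc_linear:
  assumes "bounded_linear h" "f \<in> L1_loc"
  shows "(\<lambda>x. h (f x)) \<in> L1_loc"
proof -
  have "set_integrable lborel {a..b} (\<lambda>x. h (f x))" for a b
    using integrable_bounded_linear[OF assms(1)
        L1_loc_set_integrable[OF assms(2), unfolded set_integrable_def], of a b]
    by (simp add: set_integrable_def linear_simps(5)[OF assms(1)])
  moreover have "(\<lambda>x. h (f x)) \<in> borel_measurable borel"
    using borel_measurable_continuous_on[OF linear_continuous_on[OF assms(1)]
        L1_loc_measurable[OF assms(2)]] .
  ultimately show ?thesis by (simp add: L1_loc_iff_interval)
qed

lemma L1_loc_minus: "f \<in> L1_loc \<Longrightarrow> (\<lambda>x. - f x) \<in> L1_loc"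
  by (rule L1_loc_linear[OF bounded_linear_minus[OF bounded_linear_ident]])

lemma L1_loc_norm: "f \<in> L1_loc \<Longrightarrow> (\<lambda>x. norm (f x)) \<in> L1_loc"
  by (rule L1_loc_bound[of _ f]) (auto dest: L1_loc_measurable)

lemma L1_loc_continuous:
  assumes "continuous_on UNIV f" shows "f \<in> L1_loc"
  unfolding L1_loc_iff_interval set_integrable_def
  using borel_integrable_compact[OF compact_Icc continuous_on_subset[OF assms subset_UNIV]]
    borel_measurable_continuous_onI[OF assms] by blast

lemma borel_measurable_bilinear:
  fixes p :: "'a::euclidean_space \<Rightarrow> 'b::euclidean_space \<Rightarrow> 'c::euclidean_space"
  assumes "bounded_bilinear p" "f \<in> borel_measurable M" "g \<in> borel_measurable M"
  shows "(\<lambda>x. p (f x) (g x)) \<in> borel_measurable M"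
proof (rule borel_measurable_continuous_Pair[OF assms(2,3)])
  show "continuous_on UNIV (\<lambda>x. p (fst x) (snd x))"
    by (rule bounded_bilinear.continuous_on[OF assms(1) continuous_on_fst[OF continuous_on_id]
          continuous_on_snd[OF continuous_on_id]])
qed

text \<open>A continuous factor is bounded on every compact interval, so it cannot destroy local
  integrability. Stating this for an arbitrary bounded bilinear \<open>p\<close> covers scalar
  multiplication, the real product and the real inner product at once.\<close>

lemma L1_loc_bilinear:
  fixes p :: "'a::euclidean_space \<Rightarrow> 'b::euclidean_space \<Rightarrow> 'c::euclidean_space"
  assumes p: "bounded_bilinear p" and f: "continuous_on UNIV f" and g: "g \<in> L1_loc"
  shows "(\<lambda>x. p (f x) (g x)) \<in> L1_loc"
proof -
  have m: "(\<lambda>x. p (f x) (g x)) \<in> borel_measurable borel"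
    using borel_measurable_bilinear[OF p borel_measurable_continuous_onI[OF f] L1_loc_measurable[OF g]] .
  obtain K where K: "\<And>x y. norm (p x y) \<le> norm x * norm y * K" "K \<ge> 0"
    using bounded_bilinear.nonneg_bounded[OF p] by blast
  have "set_integrable lborel {a..b} (\<lambda>x. p (f x) (g x))" for a b
  proof -
    have "bounded (f ` {a..b})"
      by (intro compact_imp_bounded compact_continuous_image continuous_on_subset[OF f]) auto
    then obtain M where M: "\<forall>y\<in>f ` {a..b}. norm y \<le> M"
      unfolding bounded_iff by blast
    show ?thesis
      unfolding set_integrable_def
    proof (rule Bochner_Integration.integrable_bound)
      show "integrable lborel (\<lambda>x. (\<bar>M\<bar> * K) *\<^sub>R (indicator {a..b} x *\<^sub>R g x))"
        using L1_loc_set_integrable[OF g, of a b] unfolding set_integrable_def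
        by (rule integrable_scaleR_right)
      show "(\<lambda>x. indicator {a..b} x *\<^sub>R p (f x) (g x)) \<in> borel_measurable lborel"
        using m by measurable
      have "norm (p (f x) (g x)) \<le> \<bar>M\<bar> * K * norm (g x)" if "x \<in> {a..b}" for x
      proof -
        have "norm (f x) * norm (g x) * K \<le> \<bar>M\<bar> * norm (g x) * K"
          using M that K(2) by (intro mult_right_mono) force+
        then show ?thesis using K(1)[of "f x" "g x"] by (simp add: mult_ac)
      qed
      then show "AE x in lborel. norm (indicator {a..b} x *\<^sub>R p (f x) (g x)) \<le>
           norm ((\<bar>M\<bar> * K) *\<^sub>R (indicator {a..b} x *\<^sub>R g x))"
        using K(2) by (auto simp: indicator_def)
    qed
  qed
  then show ?thesis using m by (simp add: L1_loc_iff_interval)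
qed

lemma L2_norm_sq_L1_loc: "f \<in> L2 \<Longrightarrow> (\<lambda>x. (norm (f x))\<^sup>2) \<in> L1_loc"
  unfolding L1_loc_iff_interval set_integrable_def L2_def
  by (auto simp flip: real_scaleR_def intro!: integrable_mult_indicator)

lemma AE_imp_negligible:
  assumes "AE x in lborel. P (x::real)"
  obtains N where "negligible N" "\<And>x. x \<notin> N \<Longrightarrow> P x"
proof -
  obtain N where N: "N \<in> null_sets lborel" "{x. \<not> P x} \<subseteq> N"
    using assms by (auto simp: eventually_ae_filter)
  then have "negligible N" by (simp add: negligible_iff_null_sets null_sets_completionI)
  then show thesis using N(2) by (intro that[of N]) auto
qed

text \<open>By Lebesgue differentiation, \<open>g x\<close> is for almost every \<open>x\<close> the
  limit of the averages of \<open>g\<close> over short intervals starting at \<open>x\<close>, and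
  these averages are zero. Borel measurability of \<open>g\<close> turns the Lebesgue null set into
  a null set of \<open>lborel\<close>.\<close>

lemma L1_loc_AE_zero:
  fixes g :: "real \<Rightarrow> 'a::euclidean_space"
  assumes g: "g \<in> L1_loc" and z: "\<And>a b. a < b \<Longrightarrow> integral {a..b} g = 0"
  shows "AE x in lborel. g x = 0"
proof -
  obtain N where N: "negligible N"
       "\<And>x e. \<lbrakk>x \<notin> N; 0 < e\<rbrakk> \<Longrightarrow> \<exists>d>0. \<forall>h. 0 < h \<and> h < d \<longrightarrow>
                         norm (integral (cbox x (x + h *\<^sub>R One)) g /\<^sub>R h ^ DIM(real) - g x) < e"
    using integrable_ccontinuous_explicit[of g] L1_loc_integrable_on[OF g] by (metis interval_cbox)
  have "g x = 0" if xN: "x \<notin> N" for x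
  proof (rule ccontr)
    assume "g x \<noteq> 0"
    then obtain d where d: "d > 0" "\<forall>h. 0 < h \<and> h < d \<longrightarrow>
        norm (integral (cbox x (x + h *\<^sub>R One)) g /\<^sub>R h ^ DIM(real) - g x) < norm (g x)"
      using N(2)[OF xN, of "norm (g x)"] by auto
    from d(2)[rule_format, of "d/2"] d(1) z[of x "x + d/2"] show False
      by simp
  qed
  then have "{x. g x \<noteq> 0} \<subseteq> N" by auto
  then have "{x. g x \<noteq> 0} \<in> null_sets lebesgue"
    using N(1) negligible_iff_null_sets negligible_subset by blast
  moreover have "{x. g x \<noteq> 0} \<in> sets borel"
    using borel_measurable_vimage[of g borel 0] L1_loc_measurable[OF g] by measurable
  ultimately have "{x. g x \<noteq> 0} \<in> null_sets lborel"
    by (auto simp: null_sets_def)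
  then show ?thesis by (rule AE_I') auto
qed

section \<open>Smooth functions and bumps\<close>

text \<open>A class of functions closed under differentiation contains every iterated derivative of
  its members. Smoothness thus reduces to exhibiting such a class, without computing any
  iterate.\<close>

lemma smooth_coinduct:
  assumes f: "f \<in> S"
    and S: "\<And>f. f \<in> S \<Longrightarrow> \<exists>g\<in>S. \<forall>x. (f has_vector_derivative g x) (at x)"
  shows "smooth f"
proof -
  have "((\<lambda>g t. vector_derivative g (at t)) ^^ n) f \<in> S" for n
  proof (induction n)
    case (Suc n)
    then obtain g where g: "g \<in> S"
      "\<And>x. (((\<lambda>g t. vector_derivative g (at t)) ^^ n) f has_vector_derivative g x) (at x)"
      using S by blast
    then have "((\<lambda>g t. vector_derivative g (at t)) ^^ Suc n) f = g"
      by (auto simp: vector_derivative_at)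
    then show ?case using g by simp
  qed (simp add: f)
  then show ?thesis unfolding smooth_def using S differentiableI_vector by blast
qed

lemma smooth_has_derivative:
  assumes "smooth f"
  shows "(f has_vector_derivative vector_derivative f (at x)) (at x)"
  using assms[unfolded smooth_def, rule_format, of 0 x] by (simp flip: vector_derivative_works)

lemma smooth_derivative: "smooth f \<Longrightarrow> smooth (\<lambda>t. vector_derivative f (at t))"
  unfolding smooth_def
  by (metis (no_types, lifting) funpow_swap1 funpow.simps(2) o_apply)

lemma smooth_continuous: "smooth f \<Longrightarrow> continuous_on UNIV f"
  by (meson continuous_at_imp_continuous_on has_vector_derivative_continuous smooth_has_derivative)

lemma smooth_antiderivative:
  assumes "smooth f" "\<And>x. (g has_vector_derivative f x) (at x)"
  shows "smooth g"
proof (rule smooth_coinduct[of _ "insert g (Collect smooth)"])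
  fix h assume "h \<in> insert g (Collect smooth)"
  then have "\<exists>k\<in>Collect smooth. \<forall>x. (h has_vector_derivative k x) (at x)"
  proof
    assume "h = g" then show ?thesis using assms by (intro bexI[of _ f]) auto
  next
    assume "h \<in> Collect smooth" then show ?thesis
      by (intro bexI[of _ "\<lambda>t. vector_derivative h (at t)"])
        (auto intro: smooth_derivative smooth_has_derivative)
  qed
  then show "\<exists>k\<in>insert g (Collect smooth). \<forall>x. (h has_vector_derivative k x) (at x)"
    by auto
qed simp

lemma smooth_const: "smooth (\<lambda>_. c)"
  by (rule smooth_coinduct[of _ "range (\<lambda>c _. c)"])
    (auto intro!: exI[of _ 0] has_vector_derivative_const)

lemma smooth_scaleR_const:
  fixes f :: "real \<Rightarrow> real" and e :: "'a::euclidean_space"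
  assumes "smooth f" shows "smooth (\<lambda>x. f x *\<^sub>R e)"
proof (rule smooth_coinduct[of _ "{\<lambda>x. f x *\<^sub>R e |f. smooth f}"])
  fix h assume "h \<in> {\<lambda>x. f x *\<^sub>R e |f. smooth f}"
  then obtain f where f: "smooth f" "h = (\<lambda>x. f x *\<^sub>R e)" by auto
  then have "(h has_vector_derivative (vector_derivative f (at x)) *\<^sub>R e) (at x)" for x
    using bounded_linear.has_vector_derivative[OF bounded_linear_scaleR_left smooth_has_derivative]
    by fastforce
  then show "\<exists>g\<in>{\<lambda>x. f x *\<^sub>R e |f. smooth f}. \<forall>x. (h has_vector_derivative g x) (at x)"
    using smooth_derivative[OF f(1)] by (intro bexI[of _ "\<lambda>x. vector_derivative f (at x) *\<^sub>R e"]) auto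
qed (use assms in auto)

lemma smooth_affine:
  fixes f :: "real \<Rightarrow> real"
  assumes "smooth f" shows "smooth (\<lambda>x. f (m * x + b))"
proof -
  \<comment> \<open>Each differentiation produces a factor \<open>m\<close>; the free constant
    \<open>k\<close> makes the class closed under the chain rule.\<close>
  have "smooth (\<lambda>x. k * f (m * x + b))" for k :: real
  proof (rule smooth_coinduct[of _ "{\<lambda>x. k * f (m * x + b) |(k::real) f. smooth f}"])
    fix h assume "h \<in> {\<lambda>x. k * f (m * x + b) |(k::real) f. smooth f}"
    then obtain k :: real and f where f: "smooth f" "h = (\<lambda>x. k * f (m * x + b))" by auto
    have "(h has_vector_derivative (k * m) * vector_derivative f (at (m * x + b))) (at x)" for x
    proof -
      have "(f has_real_derivative vector_derivative f (at (m * x + b))) (at (m * x + b))"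
        using smooth_has_derivative[OF f(1)] by (simp add: has_real_derivative_iff_has_vector_derivative)
      then show ?thesis
        unfolding f(2) has_real_derivative_iff_has_vector_derivative[symmetric]
        by (auto intro!: derivative_eq_intros DERIV_chain'[where g=f])
    qed
    then show "\<exists>g\<in>{\<lambda>x. k * f (m * x + b) |(k::real) f. smooth f}. \<forall>x. (h has_vector_derivative g x) (at x)"
      using smooth_derivative[OF f(1)]
      by (intro bexI[of _ "\<lambda>x. (k * m) * vector_derivative f (at (m * x + b))"]) auto
  qed (use assms in auto)
  from this[of 1] show ?thesis by simp
qed

lemma smooth_add:
  assumes "smooth f" "smooth g" shows "smooth (\<lambda>x. f x + g x)"
proof (rule smooth_coinduct[of _ "{\<lambda>x. f x + g x |f g. smooth f \<and> smooth g}"])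
  fix h assume "h \<in> {\<lambda>x. f x + g x |f g. smooth f \<and> smooth g}"
  then obtain f g where f: "smooth f" "smooth g" "h = (\<lambda>x. f x + g x)" by auto
  then show "\<exists>g\<in>{\<lambda>x. f x + g x |f g. smooth f \<and> smooth g}. \<forall>x. (h has_vector_derivative g x) (at x)"
    by (intro bexI[of _ "\<lambda>x. vector_derivative f (at x) + vector_derivative g (at x)"])
      (auto intro!: has_vector_derivative_add smooth_has_derivative smooth_derivative)
qed (use assms in auto)

text \<open>The derivative of a product is a sum of two products, so products alone are not closed
  under differentiation; their finite sums are.\<close>

inductive_set product_sums :: "(real \<Rightarrow> real) set" where
  mult: "smooth f \<Longrightarrow> smooth g \<Longrightarrow> (\<lambda>x. f x * g x) \<in> product_sums"
| add: "f \<in> product_sums \<Longrightarrow> g \<in> product_sums \<Longrightarrow> (\<lambda>x. f x + g x) \<in> product_sums"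

lemma smooth_mult:
  fixes f g :: "real \<Rightarrow> real"
  assumes "smooth f" "smooth g" shows "smooth (\<lambda>x. f x * g x)"
proof (rule smooth_coinduct[of _ product_sums])
  fix h assume "h \<in> product_sums"
  then show "\<exists>g\<in>product_sums. \<forall>x. (h has_vector_derivative g x) (at x)"
  proof induction
    case (mult f g)
    then show ?case
      by (intro bexI[of _ "\<lambda>x. f x * vector_derivative g (at x) + vector_derivative f (at x) * g x"])
        (auto intro!: has_vector_derivative_mult smooth_has_derivative smooth_derivative product_sums.intros)
  next
    case (add f g)
    then obtain f' g' where "f' \<in> product_sums" "g' \<in> product_sums"
      "\<And>x. (f has_vector_derivative f' x) (at x)" "\<And>x. (g has_vector_derivative g' x) (at x)" by blast
    then show ?case
      by (intro bexI[of _ "\<lambda>x. f' x + g' x"]) (auto intro!: has_vector_derivative_add product_sums.add)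
  qed
qed (use assms in \<open>auto intro: product_sums.mult\<close>)

text \<open>For \<open>p = 1\<close> this is the classical function that is flat at 0. The
  polynomial in \<open>1 / x\<close> is carried along so that the family contains its own
  derivatives.\<close>

definition flat_exp :: "real poly \<Rightarrow> real \<Rightarrow> real" where
  "flat_exp p x = (if x > 0 then poly p (1 / x) * exp (- 1 / x) else 0)"

lemma poly_over_exp_tendsto_0: "((\<lambda>t::real. poly p t / exp t) \<longlongrightarrow> 0) at_top"
proof -
  have "((\<lambda>t::real. \<Sum>i\<le>degree p. coeff p i * (t ^ i / exp t)) \<longlongrightarrow> (\<Sum>i\<le>degree p. coeff p i * 0)) at_top"
    by (intro tendsto_sum tendsto_mult tendsto_const tendsto_power_div_exp_0)
  then show ?thesis by (simp add: poly_altdef sum_divide_distrib)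
qed

text \<open>With \<open>t = 1 / x\<close> one has \<open>d/dx = - t^2 d/dt\<close>, so
  \<open>p(t) exp(-t)\<close> becomes \<open>t^2 (p - p')(t) exp(-t)\<close>; the coefficient list
  \<open>[:0, 0, 1:]\<close> is \<open>t^2\<close>. At 0 the exponential beats every
  polynomial.\<close>

lemma flat_exp_derivative:
  "(flat_exp p has_real_derivative flat_exp ([:0, 0, 1:] * (p - pderiv p)) x) (at x)"
proof -
  consider "x > 0" | "x < 0" | "x = 0" by linarith
  then show ?thesis
  proof cases
    case 1
    have "((\<lambda>x. poly p (1 / x) * exp (- 1 / x)) has_real_derivative
        flat_exp ([:0, 0, 1:] * (p - pderiv p)) x) (at x)"
    proof -
      have "((\<lambda>x. poly p (1 / x)) has_real_derivative poly (pderiv p) (1 / x) * (- 1 / x\<^sup>2)) (at x)"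
        by (rule DERIV_chain'[OF _ poly_DERIV])
          (use 1 in \<open>auto intro!: derivative_eq_intros simp: power2_eq_square\<close>)
      moreover have "((\<lambda>x. exp (- 1 / x)) has_real_derivative exp (- 1 / x) * (1 / x\<^sup>2)) (at x)"
        using 1 by (auto intro!: derivative_eq_intros simp: power2_eq_square)
      ultimately have "((\<lambda>x. poly p (1 / x) * exp (- 1 / x)) has_real_derivative
          poly (pderiv p) (1 / x) * (- 1 / x\<^sup>2) * exp (- 1 / x)
            + exp (- 1 / x) * (1 / x\<^sup>2) * poly p (1 / x)) (at x)"
        by (rule DERIV_mult)
      then show ?thesis
        by (rule DERIV_cong) (use 1 in \<open>simp add: flat_exp_def power2_eq_square algebra_simps\<close>)
    qed
    moreover have "\<forall>\<^sub>F y in nhds x. poly p (1 / y) * exp (- 1 / y) = flat_exp p y"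
      by (rule eventually_nhds_in_open[of "{0<..}", THEN eventually_mono]) (use 1 in \<open>auto simp: flat_exp_def\<close>)
    ultimately show ?thesis by (rule DERIV_cong_ev[THEN iffD1, OF refl _ refl, rotated])
  next
    case 2
    have "((\<lambda>x. 0) has_real_derivative flat_exp ([:0, 0, 1:] * (p - pderiv p)) x) (at x)"
      using 2 by (auto simp: flat_exp_def)
    moreover have "\<forall>\<^sub>F y in nhds x. 0 = flat_exp p y"
      by (rule eventually_nhds_in_open[of "{..<0}", THEN eventually_mono]) (use 2 in \<open>auto simp: flat_exp_def\<close>)
    ultimately show ?thesis by (rule DERIV_cong_ev[THEN iffD1, OF refl _ refl, rotated])
  next
    case 3
    \<comment> \<open>The difference quotient at 0 divides by \<open>h\<close>; this additional
      \<open>1 / h\<close> is absorbed into the polynomial as the factor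
      \<open>[:0, 1:]\<close>.\<close>
    have "((\<lambda>h. poly ([:0, 1:] * p) (inverse h) / exp (inverse h)) \<longlongrightarrow> 0) (at_right 0)"
      by (rule filterlim_compose[OF poly_over_exp_tendsto_0 filterlim_inverse_at_top_right])
    then have "((\<lambda>h. flat_exp p h / h) \<longlongrightarrow> 0) (at_right 0)"
      by (rule Lim_transform_eventually)
        (auto simp: eventually_at_right_less flat_exp_def exp_minus field_simps
          intro!: eventually_mono[OF eventually_at_right_less[of 0]])
    moreover have "((\<lambda>h. flat_exp p h / h) \<longlongrightarrow> 0) (at_left 0)"
      by (rule Lim_transform_eventually[OF tendsto_const])
        (auto intro!: eventually_mono[OF eventually_at_left_real[of "-1" 0]] simp: flat_exp_def)
    ultimately have "((\<lambda>h. flat_exp p h / h) \<longlongrightarrow> 0) (at 0)"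
      by (simp add: filterlim_split_at)
    then show ?thesis using 3 by (simp add: DERIV_def flat_exp_def)
  qed
qed

lemma smooth_flat_exp: "smooth (flat_exp p)"
  by (rule smooth_coinduct[of _ "range flat_exp"])
    (use flat_exp_derivative in \<open>auto simp: has_real_derivative_iff_has_vector_derivative\<close>)

section \<open>Test functions and their supports\<close>

lemma test_functionsI:
  fixes f :: "real \<Rightarrow> 'a::euclidean_space"
  assumes "smooth f" "\<And>x. x \<notin> {a..b} \<Longrightarrow> f x = 0"
  shows "f \<in> test_functions"
proof -
  have "closure {x. f x \<noteq> 0} \<subseteq> {a..b}"
    by (rule closure_minimal) (use assms(2) in force, simp)
  then have "compact (closure {x. f x \<noteq> 0})"
    by (metis closed_closure compact_Icc compact_Int_closed inf.absorb_iff2 inf_commute)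
  then show ?thesis using assms by (simp add: test_functions_def)
qed

text \<open>The interval is chosen strictly larger than the support, so that the function and its
  derivative vanish at the endpoints too and boundary terms disappear.\<close>

lemma test_functions_support:
  fixes f :: "real \<Rightarrow> 'a::euclidean_space"
  assumes "f \<in> test_functions"
  obtains a b where "a < b" "\<And>x. x \<notin> {a<..<b} \<Longrightarrow> f x = 0"
    "\<And>x. x \<notin> {a<..<b} \<Longrightarrow> vector_derivative f (at x) = 0"
proof -
  have "bounded (closure {x. f x \<noteq> 0})" using assms by (simp add: test_functions_def compact_imp_bounded)
  then obtain B where B: "\<And>x. x \<in> closure {x. f x \<noteq> 0} \<Longrightarrow> \<bar>x\<bar> \<le> B"
    unfolding bounded_iff real_norm_def by blast
  have z: "f x = 0" "vector_derivative f (at x) = 0" if x: "\<bar>x\<bar> > B" for x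
  proof -
    have nc: "x \<notin> closure {x. f x \<noteq> 0}" using B x by force
    then show "f x = 0" using closure_subset[of "{x. f x \<noteq> 0}"] by auto
    have "\<forall>\<^sub>F y in nhds x. y \<in> - closure {x. f x \<noteq> 0}"
      by (rule eventually_nhds_in_open) (use nc in auto)
    then have "\<forall>\<^sub>F y in nhds x. 0 = f y"
      by (rule eventually_mono) (use closure_subset[of "{x. f x \<noteq> 0}"] in auto)
    then have "(f has_vector_derivative 0) (at x)"
      using has_derivative_transform_eventually[of "\<lambda>_. 0" "\<lambda>_. 0" x UNIV f]
        \<open>f x = 0\<close> by (simp add: has_vector_derivative_def eventually_nhds_conv_at)
    then show "vector_derivative f (at x) = 0" by (rule vector_derivative_at)
  qed
  show ?thesis
    by (rule that[of "- \<bar>B\<bar> - 1" "\<bar>B\<bar> + 1"]) (use z in auto)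
qed

text \<open>For \<open>n \<rightarrow> \<infinity>\<close> these bumps increase to the indicator function of \<open>(a, b)\<close>.\<close>

definition bump :: "real \<Rightarrow> real \<Rightarrow> nat \<Rightarrow> real \<Rightarrow> real" where
  "bump a b n x = flat_exp 1 (real (Suc n) * (x - a)) * flat_exp 1 (real (Suc n) * (b - x))"

lemma bump_outside: "x \<notin> {a<..<b} \<Longrightarrow> bump a b n x = 0"
  by (auto simp: bump_def flat_exp_def zero_less_mult_iff)

lemma bump_pos: "x \<in> {a<..<b} \<Longrightarrow> bump a b n x > 0"
  by (simp add: bump_def flat_exp_def)

lemma bump_test: "bump a b n \<in> test_functions"
proof (rule test_functionsI[where a=a and b=b])
  have "smooth (\<lambda>x. flat_exp 1 (real (Suc n) * x + - real (Suc n) * a)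
      * flat_exp 1 (- real (Suc n) * x + real (Suc n) * b))"
    by (intro smooth_mult smooth_affine smooth_flat_exp)
  then show "smooth (bump a b n)" unfolding bump_def[abs_def] by (simp add: algebra_simps)
qed (use bump_outside in auto)

lemma bump_le: "\<bar>bump a b n x\<bar> \<le> indicator {a..b} x"
proof (cases "x \<in> {a<..<b}")
  case True
  then show ?thesis
    by (auto simp: bump_def flat_exp_def abs_mult intro!: mult_le_one)
qed (simp add: bump_outside)

lemma bump_tendsto: "(\<lambda>n. bump a b n x) \<longlonglongrightarrow> indicator {a<..<b} x"
proof (cases "x \<in> {a<..<b}")
  case True
  have *: "(\<lambda>n. flat_exp 1 (real (Suc n) * y)) \<longlonglongrightarrow> 1" if "y > 0" for y
  proof -
    have "(\<lambda>n. exp (- (1 / y) * inverse (real (Suc n)))) \<longlonglongrightarrow> exp (- (1/y) * 0)"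
      by (intro tendsto_intros LIMSEQ_inverse_real_of_nat)
    moreover have "flat_exp 1 (real (Suc n) * y) = exp (- (1 / y) * inverse (real (Suc n)))" for n
      using that unfolding flat_exp_def by (simp add: zero_less_mult_iff divide_simps)
    ultimately show ?thesis by simp
  qed
  have "(\<lambda>n. bump a b n x) \<longlonglongrightarrow> 1 * 1"
    unfolding bump_def by (intro tendsto_mult *) (use True in auto)
  then show ?thesis using True by simp
qed (simp add: bump_outside)

section \<open>Absolute continuity and weak derivatives\<close>

text \<open>This is local absolute continuity of \<open>f\<close> with density \<open>g\<close>. The
  integral form avoids differentiating \<open>f\<close> almost everywhere and leaves
  \<open>g\<close> free to change on null sets, as suits weak derivatives.\<close>

definition has_L1_derivative :: "(real \<Rightarrow> 'a::euclidean_space) \<Rightarrow> (real \<Rightarrow> 'a) \<Rightarrow> bool" where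
  "has_L1_derivative f g \<longleftrightarrow> g \<in> L1_loc \<and> (\<forall>a b. a \<le> b \<longrightarrow> (g has_integral f b - f a) {a..b})"

lemma has_L1_derivative_L1_loc: "has_L1_derivative f g \<Longrightarrow> g \<in> L1_loc"
  by (simp add: has_L1_derivative_def)

lemma has_L1_derivative_integral:
  "has_L1_derivative f g \<Longrightarrow> a \<le> b \<Longrightarrow> (g has_integral f b - f a) {a..b}"
  by (simp add: has_L1_derivative_def)

lemma has_L1_derivative_continuous:
  assumes "has_L1_derivative f g" shows "continuous_on UNIV f"
proof -
  have "isCont f x" for x
  proof -
    have "continuous_on {x - 1..x + 1} (\<lambda>t. f (x - 1) + integral {x - 1..t} g)"
      by (intro continuous_intros indefinite_integral_continuous_1
          L1_loc_integrable_on has_L1_derivative_L1_loc[OF assms])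
    moreover have "f (x - 1) + integral {x - 1..t} g = f t" if "t \<in> {x - 1..x + 1}" for t
      using integral_unique[OF has_L1_derivative_integral[OF assms, of "x - 1" t]] that by simp
    ultimately have "continuous_on {x - 1..x + 1} f" by (simp cong: continuous_on_cong_simp)
    then show ?thesis by (rule continuous_on_interior) simp
  qed
  then show ?thesis by (simp add: continuous_at_imp_continuous_on)
qed

lemma has_L1_derivative_AE_cong:
  assumes "has_L1_derivative f g" "h \<in> L1_loc" "AE x in lborel. g x = h x"
  shows "has_L1_derivative f h"
proof -
  obtain N where "negligible N" "\<And>x. x \<notin> N \<Longrightarrow> g x = h x"
    using AE_imp_negligible[OF assms(3)] by blast
  then show ?thesis
    using assms(1,2) unfolding has_L1_derivative_def
    by (metis (no_types, lifting) DiffE has_integral_spike)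
qed

lemma has_L1_derivative_zero_imp_const:
  assumes "has_L1_derivative f g" "AE x in lborel. g x = 0"
  shows "f x = f y"
proof -
  have "has_L1_derivative f (\<lambda>_. 0)"
    by (rule has_L1_derivative_AE_cong[OF assms(1) _ assms(2)]) (simp add: L1_loc_continuous)
  then have "f b = f a" if "a \<le> b" for a b
    using has_integral_unique[OF has_L1_derivative_integral[OF _ that] has_integral_0] by fastforce
  then show ?thesis by (metis linear)
qed

lemma has_L1_derivative_linear:
  assumes "bounded_linear h" "has_L1_derivative f g"
  shows "has_L1_derivative (\<lambda>x. h (f x)) (\<lambda>x. h (g x))"
  unfolding has_L1_derivative_def
proof (intro conjI allI impI)
  show "(\<lambda>x. h (g x)) \<in> L1_loc"
    by (rule L1_loc_linear[OF assms(1) has_L1_derivative_L1_loc[OF assms(2)]])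
  show "((\<lambda>x. h (g x)) has_integral h (f b) - h (f a)) {a..b}" if "a \<le> b" for a b
    using has_integral_linear[OF has_L1_derivative_integral[OF assms(2) that] assms(1)]
    by (simp add: o_def linear_simps(2)[OF assms(1)])
qed

lemma has_L1_derivative_add:
  assumes "has_L1_derivative f g" "has_L1_derivative f' g'"
  shows "has_L1_derivative (\<lambda>x. f x + f' x) (\<lambda>x. g x + g' x)"
  unfolding has_L1_derivative_def
proof (intro conjI allI impI)
  show "((\<lambda>x. g x + g' x) has_integral (f b + f' b) - (f a + f' a)) {a..b}" if "a \<le> b" for a b
    using has_integral_add[OF assms[THEN has_L1_derivative_integral[OF _ that]]]
    by (simp add: algebra_simps)
qed (use assms L1_loc_add has_L1_derivative_L1_loc in blast)

lemma has_L1_derivative_exists: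
  assumes g: "g \<in> L1_loc"
  obtains f where "has_L1_derivative f g" "f c = 0"
proof -
  define f where "f x = (if c \<le> x then integral {c..x} g else - integral {x..c} g)" for x
  note [simp] = L1_loc_integrable_on[OF g]
  have "(g has_integral f b - f a) {a..b}" if ab: "a \<le> b" for a b
  proof -
    have "integral {a..b} g = f b - f a"
    proof -
      consider "c \<le> a" | "a < c" "c \<le> b" | "b < c" by linarith
      then show ?thesis
      proof cases
        case 1
        then show ?thesis
          using Henstock_Kurzweil_Integration.integral_combine[of c a b g] ab by (simp add: f_def algebra_simps)
      next
        case 2
        then show ?thesis
          using Henstock_Kurzweil_Integration.integral_combine[of a c b g] ab by (simp add: f_def algebra_simps)
      next
        case 3
        then show ?thesis
          using Henstock_Kurzweil_Integration.integral_combine[of a b c g] ab by (simp add: f_def algebra_simps)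
      qed
    qed
    then show ?thesis using integrable_integral[of g "{a..b}"] by simp
  qed
  then have "has_L1_derivative f g" using g by (simp add: has_L1_derivative_def)
  moreover have "f c = 0" by (simp add: f_def)
  ultimately show thesis by (rule that)
qed

lemma has_L1_derivative_classical:
  assumes "\<And>x. (f has_vector_derivative g x) (at x)" "continuous_on UNIV g"
  shows "has_L1_derivative f g"
  unfolding has_L1_derivative_def
proof (intro conjI allI impI)
  show "(g has_integral f b - f a) {a..b}" if "a \<le> b" for a b
    using that has_vector_derivative_at_within[OF assms(1)] by (rule fundamental_theorem_of_calculus)
qed (rule L1_loc_continuous[OF assms(2)])

lemma has_L1_derivative_continuous_derivative:
  assumes f: "has_L1_derivative f g" and g: "continuous_on UNIV g"
  shows "(f has_vector_derivative g x) (at x)"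
proof -
  have "((\<lambda>t. integral {x - 1..t} g) has_vector_derivative g x) (at x within {x - 1..x + 1})"
    by (rule integral_has_vector_derivative) (auto intro: continuous_on_subset[OF g])
  then have "((\<lambda>t. f (x - 1) + integral {x - 1..t} g) has_vector_derivative g x) (at x within {x - 1..x + 1})"
    by (auto intro!: derivative_eq_intros)
  then have "(f has_vector_derivative g x) (at x within {x - 1..x + 1})"
  proof (rule has_vector_derivative_transform[rotated 2])
    show "f t = f (x - 1) + integral {x - 1..t} g" if "t \<in> {x - 1..x + 1}" for t
      using integral_unique[OF has_L1_derivative_integral[OF f, of "x - 1" t]] that by simp
  qed simp
  then show ?thesis by (simp add: at_within_Icc_at)
qed

text \<open>The increments of the product over short intervals agree with the integral of the
  candidate derivative up to a small multiple of the integral of the norms; Bolzano's principle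
  adds these errors up.\<close>

lemma has_L1_derivative_bilinear:
  fixes p :: "'a::euclidean_space \<Rightarrow> 'b::euclidean_space \<Rightarrow> 'c::euclidean_space"
  assumes p: "bounded_bilinear p"
    and 1: "has_L1_derivative f1 g1" and 2: "has_L1_derivative f2 g2"
  shows "has_L1_derivative (\<lambda>x. p (f1 x) (f2 x)) (\<lambda>x. p (g1 x) (f2 x) + p (f1 x) (g2 x))"
proof -
  interpret p: bounded_bilinear p by (rule p)
  obtain K where K: "\<And>x y. norm (p x y) \<le> norm x * norm y * K" "K > 0"
    using p.pos_bounded by blast
  note c1 = has_L1_derivative_continuous[OF 1] and c2 = has_L1_derivative_continuous[OF 2]
  note g1 = has_L1_derivative_L1_loc[OF 1] and g2 = has_L1_derivative_L1_loc[OF 2]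
  define h where "h x = p (g1 x) (f2 x) + p (f1 x) (g2 x)" for x
  define k where "k x = norm (g1 x) + norm (g2 x)" for x
  have h: "h \<in> L1_loc"
    unfolding h_def by (intro L1_loc_add L1_loc_bilinear[OF p.flip c2 g1] L1_loc_bilinear[OF p c1 g2])
  have k: "k \<in> L1_loc" unfolding k_def by (intro L1_loc_add L1_loc_norm g1 g2)
  define D where "D x y = p (f1 y) (f2 y) - p (f1 x) (f2 x) - integral {x..y} h" for x y
  have short: "norm (D x y) \<le> K * e * integral {x..y} k"
    if xy: "x \<le> y" and e1: "\<And>s t. s \<in> {x..y} \<Longrightarrow> t \<in> {x..y} \<Longrightarrow> norm (f1 s - f1 t) \<le> e"
      and e2: "\<And>s t. s \<in> {x..y} \<Longrightarrow> t \<in> {x..y} \<Longrightarrow> norm (f2 s - f2 t) \<le> e" for x y e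
  proof -
    \<comment> \<open>Freezing \<open>f2\<close> at \<open>y\<close> and \<open>f1\<close> at
      \<open>x\<close> gives an exact formula for the increment of the product; the error against
      \<open>h\<close> then contains only oscillations of \<open>f1\<close> and
      \<open>f2\<close>.\<close>
    have "((\<lambda>t. p (g1 t) (f2 y)) has_integral p (f1 y - f1 x) (f2 y)) {x..y}"
      using has_integral_linear[OF has_L1_derivative_integral[OF 1 xy] p.bounded_linear_left]
      by (simp add: o_def)
    moreover have "((\<lambda>t. p (f1 x) (g2 t)) has_integral p (f1 x) (f2 y - f2 x)) {x..y}"
      using has_integral_linear[OF has_L1_derivative_integral[OF 2 xy] p.bounded_linear_right]
      by (simp add: o_def)
    ultimately have "((\<lambda>t. p (g1 t) (f2 y) + p (f1 x) (g2 t) - h t) has_integral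
        p (f1 y - f1 x) (f2 y) + p (f1 x) (f2 y - f2 x) - integral {x..y} h) {x..y}"
      by (intro has_integral_add has_integral_diff integrable_integral L1_loc_integrable_on[OF h])
    moreover have "p (f1 y - f1 x) (f2 y) + p (f1 x) (f2 y - f2 x) - integral {x..y} h = D x y"
      unfolding D_def by (simp add: p.diff_left p.diff_right)
    ultimately have D: "((\<lambda>t. p (g1 t) (f2 y) + p (f1 x) (g2 t) - h t) has_integral D x y) {x..y}"
      by simp
    have "norm (p (g1 t) (f2 y) + p (f1 x) (g2 t) - h t) \<le> K * e * k t" if t: "t \<in> {x..y}" for t
    proof -
      have "p (g1 t) (f2 y) + p (f1 x) (g2 t) - h t = p (g1 t) (f2 y - f2 t) + p (f1 x - f1 t) (g2 t)"
        unfolding h_def by (simp add: p.diff_left p.diff_right)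
      then have "norm (p (g1 t) (f2 y) + p (f1 x) (g2 t) - h t)
          \<le> norm (g1 t) * norm (f2 y - f2 t) * K + norm (f1 x - f1 t) * norm (g2 t) * K"
        using norm_triangle_mono[OF K(1) K(1)] by simp
      also have "\<dots> \<le> norm (g1 t) * e * K + e * norm (g2 t) * K"
        using e1[of x t] e2[of y t] t K(2) by (intro add_mono mult_right_mono mult_left_mono) auto
      finally show ?thesis by (simp add: k_def algebra_simps)
    qed
    then have "norm (integral {x..y} (\<lambda>t. p (g1 t) (f2 y) + p (f1 x) (g2 t) - h t))
        \<le> integral {x..y} (\<lambda>t. K * e * k t)"
      using has_integral_integrable[OF D] L1_loc_integrable_on[OF k]
      by (intro integral_norm_bound_integral integrable_on_mult_right) auto
    then show ?thesis using integral_unique[OF D] by simp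
  qed
  have "norm (D a b) \<le> K * e * integral {a..b} k" if "a \<le> b" "e > 0" for a b e
    using \<open>a \<le> b\<close>
  proof (induction rule: Bolzano)
    case (trans a b c)
    have "D a c = D a b + D b c"
      using Henstock_Kurzweil_Integration.integral_combine[of a b c h] trans L1_loc_integrable_on[OF h]
      by (simp add: D_def algebra_simps)
    moreover have "integral {a..c} k = integral {a..b} k + integral {b..c} k"
      using Henstock_Kurzweil_Integration.integral_combine[of a b c k] trans L1_loc_integrable_on[OF k] by simp
    ultimately show ?case
      using norm_triangle_mono[OF trans(1) trans(2)] by (simp add: algebra_simps)
  next
    case (local z)
    have "\<exists>d>0. \<forall>t. dist t z < d \<longrightarrow> dist (f1 t) (f1 z) < e/2"
         "\<exists>d>0. \<forall>t. dist t z < d \<longrightarrow> dist (f2 t) (f2 z) < e/2"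
      using c1[unfolded continuous_on_iff, rule_format, of z "e/2"]
        c2[unfolded continuous_on_iff, rule_format, of z "e/2"] \<open>e > 0\<close> by simp_all
    then obtain d1 d2 where d: "d1 > 0" "d2 > 0" "\<And>t. dist t z < d1 \<Longrightarrow> dist (f1 t) (f1 z) < e/2"
         "\<And>t. dist t z < d2 \<Longrightarrow> dist (f2 t) (f2 z) < e/2" by blast
    have "norm (D x y) \<le> K * e * integral {x..y} k" if xy: "x \<le> z" "z \<le> y" "y - x < min d1 d2" for x y
    proof (rule short)
      fix s t assume "s \<in> {x..y}" "t \<in> {x..y}"
      then have "dist s z < min d1 d2" "dist t z < min d1 d2" using xy by (auto simp: dist_real_def)
      then show "norm (f1 s - f1 t) \<le> e" "norm (f2 s - f2 t) \<le> e"
        using dist_triangle_half_l[of "f1 s" "f1 z" e "f1 t"] dist_triangle_half_l[of "f2 s" "f2 z" e "f2 t"]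
          d(3)[of s] d(3)[of t] d(4)[of s] d(4)[of t]
        by (auto simp: dist_commute dist_norm less_imp_le)
    qed (use xy in simp)
    then show ?case using d(1,2) by (intro exI[of _ "min d1 d2"]) auto
  qed
  have "D a b = 0" if "a \<le> b" for a b
  proof (rule ccontr)
    assume nz: "D a b \<noteq> 0"
    define M where "M = integral {a..b} k"
    have "M \<ge> 0"
      unfolding M_def by (rule integral_nonneg[OF L1_loc_integrable_on[OF k]]) (simp add: k_def)
    \<comment> \<open>This value of \<open>e\<close> makes the bound less than half of
      \<open>norm (D a b)\<close>. Using \<open>M + 1\<close> keeps the denominator positive when
      \<open>M = 0\<close>.\<close>
    have "norm (D a b) \<le> K * (norm (D a b) / (2 * K * (M + 1))) * M"
      using \<open>\<And>a b e. a \<le> b \<Longrightarrow> e > 0 \<Longrightarrow> norm (D a b) \<le> K * e * integral {a..b} k\<close>[OF that,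
        of "norm (D a b) / (2 * K * (M + 1))"] nz K(2) \<open>M \<ge> 0\<close> by (simp add: M_def)
    also have "\<dots> = norm (D a b) * (M / (2 * (M + 1)))" using K(2) by simp
    also have "\<dots> < norm (D a b) * 1"
      using nz \<open>M \<ge> 0\<close> by (intro mult_strict_left_mono) (auto simp: field_simps)
    finally show False by simp
  qed
  then have "(h has_integral p (f1 b) (f2 b) - p (f1 a) (f2 a)) {a..b}" if "a \<le> b" for a b
    using that integrable_integral[OF L1_loc_integrable_on[OF h], of a b] by (simp add: D_def)
  then show ?thesis using h by (simp add: has_L1_derivative_def h_def[abs_def])
qed

section \<open>Absolute continuity and weak derivatives compared\<close>

lemma L1_loc_compact_support:
  assumes h: "h \<in> L1_loc" and z: "\<And>x. x \<notin> {a..b} \<Longrightarrow> h x = 0"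
  shows "integrable lborel h" "(LBINT x. h x) = integral {a..b} h"
proof -
  have eq: "(\<lambda>x. indicator {a..b} x *\<^sub>R h x) = h" using z by (auto simp: indicator_def)
  show "integrable lborel h"
    using L1_loc_set_integrable[OF h, of a b] unfolding set_integrable_def eq .
  show "(LBINT x. h x) = integral {a..b} h"
    using set_borel_integral_eq_integral(2)[OF L1_loc_set_integrable[OF h, of a b]]
    unfolding set_lebesgue_integral_def eq .
qed

lemma test_function_smooth: "\<psi> \<in> test_functions \<Longrightarrow> smooth \<psi>"
  by (simp add: test_functions_def)

lemma test_function_scaleR:
  fixes \<psi> :: "real \<Rightarrow> real" and f :: "real \<Rightarrow> 'a::euclidean_space"
  assumes \<psi>: "\<psi> \<in> test_functions" and f: "f \<in> L1_loc"
  shows "integrable lborel (\<lambda>x. \<psi> x *\<^sub>R f x)"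
    and "integrable lborel (\<lambda>x. vector_derivative \<psi> (at x) *\<^sub>R f x)"
proof -
  obtain a b where ab: "a < b" "\<And>x. x \<notin> {a<..<b} \<Longrightarrow> \<psi> x = 0"
    "\<And>x. x \<notin> {a<..<b} \<Longrightarrow> vector_derivative \<psi> (at x) = 0"
    using test_functions_support[OF \<psi>] by blast
  show "integrable lborel (\<lambda>x. \<psi> x *\<^sub>R f x)"
    by (rule L1_loc_compact_support(1)[where a=a and b=b])
      (use ab in \<open>auto intro!: L1_loc_bilinear[OF bounded_bilinear_scaleR] f smooth_continuous
          test_function_smooth \<psi>\<close>)
  show "integrable lborel (\<lambda>x. vector_derivative \<psi> (at x) *\<^sub>R f x)"
    by (rule L1_loc_compact_support(1)[where a=a and b=b])
      (use ab in \<open>auto intro!: L1_loc_bilinear[OF bounded_bilinear_scaleR] f smooth_continuous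
          test_function_smooth smooth_derivative \<psi>\<close>)
qed

lemma smooth_has_L1_derivative:
  "smooth f \<Longrightarrow> has_L1_derivative f (\<lambda>x. vector_derivative f (at x))"
  by (intro has_L1_derivative_classical smooth_has_derivative smooth_continuous smooth_derivative)

text \<open>Integration by parts: the product rule applies to \<open>\<psi> f\<close>, and the
  boundary values vanish because \<open>\<psi>\<close> has compact support.\<close>

lemma has_L1_derivative_imp_weak:
  assumes fg: "has_L1_derivative f g"
  shows "has_weak_derivative f g"
  unfolding has_weak_derivative_def
proof (intro conjI ballI)
  show f: "f \<in> L1_loc" by (intro L1_loc_continuous has_L1_derivative_continuous[OF fg])
  show g: "g \<in> L1_loc" by (rule has_L1_derivative_L1_loc[OF fg])
  fix \<psi> :: "real \<Rightarrow> real" assume \<psi>: "\<psi> \<in> test_functions"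
  obtain a b where ab: "a < b" "\<And>x. x \<notin> {a<..<b} \<Longrightarrow> \<psi> x = 0"
    "\<And>x. x \<notin> {a<..<b} \<Longrightarrow> vector_derivative \<psi> (at x) = 0"
    using test_functions_support[OF \<psi>] by blast
  let ?h = "\<lambda>x. vector_derivative \<psi> (at x) *\<^sub>R f x + \<psi> x *\<^sub>R g x"
  have d: "has_L1_derivative (\<lambda>x. \<psi> x *\<^sub>R f x) ?h"
    by (rule has_L1_derivative_bilinear[OF bounded_bilinear_scaleR
          smooth_has_L1_derivative[OF test_function_smooth[OF \<psi>]] fg])
  have "(LBINT x. ?h x) = integral {a..b} ?h"
    using ab by (intro L1_loc_compact_support(2) has_L1_derivative_L1_loc[OF d]) auto
  also have "\<dots> = 0"
    using integral_unique[OF has_L1_derivative_integral[OF d]] ab by auto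
  finally show "(LBINT x. vector_derivative \<psi> (at x) *\<^sub>R f x) = - (LBINT x. \<psi> x *\<^sub>R g x)"
    using test_function_scaleR(2)[OF \<psi> f] test_function_scaleR(1)[OF \<psi> g]
    by (simp add: eq_neg_iff_add_eq_0)
qed

text \<open>Testing with bumps and passing to the limit by dominated convergence shows that
  \<open>g\<close> has integral zero over every interval, which forces \<open>g\<close> to vanish
  almost everywhere.\<close>

lemma fundamental_lemma:
  fixes g :: "real \<Rightarrow> 'a::euclidean_space"
  assumes g: "g \<in> L1_loc"
    and z: "\<And>\<psi>::real \<Rightarrow> real. \<psi> \<in> test_functions \<Longrightarrow> (LBINT x. \<psi> x *\<^sub>R g x) = 0"
  shows "AE x in lborel. g x = 0"
proof (rule L1_loc_AE_zero[OF g])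
  fix a b :: real assume "a < b"
  have "(\<lambda>n. LBINT x. bump a b n x *\<^sub>R g x) \<longlonglongrightarrow> (LBINT x. indicator {a<..<b} x *\<^sub>R g x)"
  proof (rule integral_dominated_convergence[where w="\<lambda>x. indicator {a..b} x * norm (g x)"])
    show "(\<lambda>x. indicator {a<..<b} x *\<^sub>R g x) \<in> borel_measurable lborel"
      using L1_loc_measurable[OF g] by measurable
    show "(\<lambda>x. bump a b n x *\<^sub>R g x) \<in> borel_measurable lborel" for n
      using test_function_scaleR(1)[OF bump_test g] by (rule borel_measurable_integrable)
    show "integrable lborel (\<lambda>x. indicat_real {a..b} x * norm (g x))"
      using L1_loc_set_integrable[OF L1_loc_norm[OF g]] by (simp add: set_integrable_def)
    show "AE x in lborel. (\<lambda>n. bump a b n x *\<^sub>R g x) \<longlonglongrightarrow> indicator {a<..<b} x *\<^sub>R g x"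
      by (intro AE_I2 tendsto_scaleR bump_tendsto tendsto_const)
    show "AE x in lborel. norm (bump a b n x *\<^sub>R g x) \<le> indicat_real {a..b} x * norm (g x)" for n
      using bump_le by (auto intro!: mult_right_mono)
  qed
  then have "(LBINT x. indicator {a<..<b} x *\<^sub>R g x) = 0"
    using z[OF bump_test] by (simp add: LIMSEQ_const_iff)
  moreover have "set_integrable lborel {a<..<b} g"
    by (rule set_integrable_subset[OF L1_loc_set_integrable[OF g, of a b]]) auto
  ultimately have "integral {a<..<b} g = 0"
    using set_borel_integral_eq_integral(2)[of "{a<..<b}" g] by (simp add: set_lebesgue_integral_def)
  then show "integral {a..b} g = 0" by (simp add: integral_open_interval_real)
qed

text \<open>The du Bois-Reymond argument: a test function of integral zero is the derivative of a
  test function. Subtracting a multiple of a fixed bump from any test function brings it into this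
  form.\<close>

lemma weak_derivative_zero_imp_const:
  fixes h :: "real \<Rightarrow> 'a::euclidean_space"
  assumes h: "h \<in> L1_loc"
    and z: "\<And>\<psi>::real \<Rightarrow> real. \<psi> \<in> test_functions \<Longrightarrow> (LBINT x. vector_derivative \<psi> (at x) *\<^sub>R h x) = 0"
  obtains C where "AE x in lborel. h x = C"
proof -
  let ?\<rho> = "bump 0 1 0"
  define I where "I = (LBINT x. ?\<rho> x)"
  have int: "integrable lborel \<psi>" if "\<psi> \<in> test_functions" for \<psi> :: "real \<Rightarrow> real"
    using test_function_scaleR(1)[OF that L1_loc_continuous[of "\<lambda>_. 1::real"]] by simp
  have "I \<noteq> 0"
  proof
    assume "I = 0"
    moreover have "?\<rho> x \<ge> 0" for x by (simp add: bump_def flat_exp_def)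
    ultimately have "AE x in lborel. ?\<rho> x = 0"
      using integral_nonneg_eq_0_iff_AE[OF int[OF bump_test, of 0 1 0]] unfolding I_def by simp
    then obtain N where N: "negligible N" "\<And>x. x \<notin> N \<Longrightarrow> ?\<rho> x = 0" using AE_imp_negligible by blast
    have "{0<..<1} \<subseteq> N" using N(2) bump_pos[of _ 0 1 0] by fastforce
    then have "negligible {0<..<1::real}" using N(1) negligible_subset by blast
    then show False using open_not_negligible[of "{0<..<1::real}"] by simp
  qed
  \<comment> \<open>The only possible constant: averaging \<open>h\<close> against the normalised
    bump must return it.\<close>
  define C where "C = (LBINT x. ?\<rho> x *\<^sub>R h x) /\<^sub>R I"
  have "(LBINT x. \<psi> x *\<^sub>R (h x - C)) = 0" if \<psi>: "\<psi> \<in> test_functions" for \<psi> :: "real \<Rightarrow> real"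
  proof -
    define m where "m = (LBINT x. \<psi> x) / I"
    \<comment> \<open>With this \<open>m\<close> the function \<open>\<theta>\<close> has integral
      zero, so its primitive starting from 0 at the left end is again 0 at the right end and
      beyond.\<close>
    define \<theta> where "\<theta> x = \<psi> x + (- m) * ?\<rho> x" for x
    have sm: "smooth \<theta>" unfolding \<theta>_def
      by (intro smooth_add smooth_mult smooth_const test_function_smooth bump_test \<psi>)
    note c = smooth_continuous[OF sm]
    obtain a0 b0 where "a0 < b0" and ab0: "\<And>x. x \<notin> {a0<..<b0} \<Longrightarrow> \<psi> x = 0"
      by (rule test_functions_support[OF \<psi>]) (rule that, assumption+)
    define a b where "a = min a0 0" and "b = max b0 1"
    have \<theta>0: "\<theta> x = 0" if "x \<notin> {a..b}" for x
    proof -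
      have "x \<notin> {a0<..<b0}" "x \<notin> {0<..<1}" using that by (auto simp: a_def b_def)
      then show ?thesis using ab0 bump_outside[of x 0 1 0] by (simp add: \<theta>_def)
    qed
    have "(LBINT x. \<theta> x) = 0"
      unfolding \<theta>_def using int[OF \<psi>] int[OF bump_test, of 0 1 0] \<open>I \<noteq> 0\<close>
      by (simp add: m_def I_def[symmetric])
    then have i0: "integral {a..b} \<theta> = 0"
      using L1_loc_compact_support(2)[OF L1_loc_continuous[OF c] \<theta>0] by simp
    obtain \<Theta> where \<Theta>: "has_L1_derivative \<Theta> \<theta>" "\<Theta> a = 0"
      using has_L1_derivative_exists[OF L1_loc_continuous[OF c]] by blast
    note d\<Theta> = has_L1_derivative_continuous_derivative[OF \<Theta>(1) c]
    have ab: "a \<le> b" by (simp add: a_def b_def)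
    have "\<Theta> b = 0" using integral_unique[OF has_L1_derivative_integral[OF \<Theta>(1) ab]] i0 \<Theta>(2) by simp
    have "\<Theta> \<in> test_functions"
    proof (rule test_functionsI[OF smooth_antiderivative[OF sm d\<Theta>]])
      fix x assume "x \<notin> {a..b}"
      then consider "x < a" | "x > b" by fastforce
      then show "\<Theta> x = 0"
      proof cases
        case 1
        have "(\<theta> has_integral 0) {x..a}"
        proof (rule has_integral_spike[OF negligible_sing[of a] _ has_integral_0])
          show "\<theta> y = 0" if "y \<in> {x..a} - {a}" for y using that \<theta>0[of y] by auto
        qed
        then show ?thesis
          using has_integral_unique[OF has_L1_derivative_integral[OF \<Theta>(1)], of x a] 1 \<Theta>(2) by fastforce
      next
        case 2
        have "(\<theta> has_integral 0) {b..x}"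
        proof (rule has_integral_spike[OF negligible_sing[of b] _ has_integral_0])
          show "\<theta> y = 0" if "y \<in> {b..x} - {b}" for y using that \<theta>0[of y] by auto
        qed
        then show ?thesis
          using has_integral_unique[OF has_L1_derivative_integral[OF \<Theta>(1)], of b x] 2 \<open>\<Theta> b = 0\<close> by fastforce
      qed
    qed
    from z[OF this] have "(LBINT x. \<theta> x *\<^sub>R h x) = 0"
      by (simp add: vector_derivative_at[OF d\<Theta>])
    moreover have "(LBINT x. \<theta> x *\<^sub>R h x) = (LBINT x. \<psi> x *\<^sub>R h x) - m *\<^sub>R (LBINT x. ?\<rho> x *\<^sub>R h x)"
      using test_function_scaleR(1)[OF \<psi> h] test_function_scaleR(1)[OF bump_test h, of 0 1 0]
      by (simp add: \<theta>_def algebra_simps flip: scaleR_scaleR)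
    moreover have "m *\<^sub>R (LBINT x. ?\<rho> x *\<^sub>R h x) = (LBINT x. \<psi> x *\<^sub>R C)"
      using int[OF \<psi>] by (simp add: m_def C_def divide_inverse)
    moreover have "integrable lborel (\<lambda>x. \<psi> x *\<^sub>R C)" using int[OF \<psi>] by simp
    ultimately show ?thesis
      using test_function_scaleR(1)[OF \<psi> h] by (simp add: scaleR_diff_right)
  qed
  then have "AE x in lborel. h x - C = 0"
    by (intro fundamental_lemma L1_loc_diff h L1_loc_continuous) auto
  then show thesis by (intro that[of C]) simp
qed

text \<open>Any primitive of \<open>g\<close> also has weak derivative \<open>g\<close>, so its
  difference from \<open>f\<close> has weak derivative zero and is almost everywhere constant. That
  constant is added to the primitive.\<close>

lemma has_weak_derivative_imp_L1_derivative:
  assumes fg: "has_weak_derivative f g"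
  obtains F where "has_L1_derivative F g" "AE x in lborel. f x = F x"
proof -
  have f: "f \<in> L1_loc" and g: "g \<in> L1_loc" using fg by (auto simp: has_weak_derivative_def)
  obtain F where F: "has_L1_derivative F g" using has_L1_derivative_exists[OF g, of 0] by blast
  then have wF: "has_weak_derivative F g" by (rule has_L1_derivative_imp_weak)
  then have F1: "F \<in> L1_loc" by (auto simp: has_weak_derivative_def)
  have "(LBINT x. vector_derivative \<psi> (at x) *\<^sub>R (f x - F x)) = 0"
    if \<psi>: "\<psi> \<in> test_functions" for \<psi> :: "real \<Rightarrow> real"
    using fg wF \<psi> test_function_scaleR(2)[OF \<psi> f] test_function_scaleR(2)[OF \<psi> F1]
    by (simp add: has_weak_derivative_def scaleR_diff_right)
  then obtain C where C: "AE x in lborel. f x - F x = C"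
    using weak_derivative_zero_imp_const[OF L1_loc_diff[OF f F1]] by blast
  show thesis
  proof (rule that)
    show "has_L1_derivative (\<lambda>x. F x + C) g"
      using F by (simp add: has_L1_derivative_def)
    show "AE x in lborel. f x = F x + C" using C by (auto simp: algebra_simps)
  qed
qed

text \<open>The set where the two functions differ is open and negligible, hence empty.\<close>

lemma continuous_AE_eq_imp_eq:
  fixes f g :: "real \<Rightarrow> 'a::euclidean_space"
  assumes "continuous_on UNIV f" "continuous_on UNIV g" "AE x in lborel. f x = g x"
  shows "f = g"
proof -
  obtain N where N: "negligible N" "\<And>x. x \<notin> N \<Longrightarrow> f x = g x" using AE_imp_negligible[OF assms(3)] by blast
  have "negligible {x. f x \<noteq> g x}" by (rule negligible_subset[OF N(1)]) (use N(2) in blast)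
  moreover have "open {x. f x \<noteq> g x}" using assms(1,2) by (intro open_Collect_neq)
  ultimately show ?thesis using open_not_negligible[of "{x. f x \<noteq> g x}"] by auto
qed

lemma continuous_weak_derivative_imp_L1_derivative:
  assumes "has_weak_derivative f g" "continuous_on UNIV f"
  shows "has_L1_derivative f g"
proof -
  obtain F where F: "has_L1_derivative F g" "AE x in lborel. f x = F x"
    using has_weak_derivative_imp_L1_derivative[OF assms(1)] .
  then have "f = F"
    using continuous_AE_eq_imp_eq[OF assms(2) has_L1_derivative_continuous] by blast
  then show ?thesis using F(1) by simp
qed

text \<open>The choice operator returns some weak derivative, and the fundamental lemma annihilates
  the difference of any two.\<close>

lemma weak_deriv_AE_eq:
  assumes "has_weak_derivative f g"
  shows "AE x in lborel. weak_deriv f x = g x"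
proof -
  have w: "has_weak_derivative f (weak_deriv f)"
    unfolding weak_deriv_def using someI[of "has_weak_derivative f", OF assms] .
  then have L: "weak_deriv f \<in> L1_loc" "g \<in> L1_loc" using assms by (auto simp: has_weak_derivative_def)
  have "AE x in lborel. weak_deriv f x - g x = 0"
  proof (rule fundamental_lemma[OF L1_loc_diff[OF L]])
    fix \<psi> :: "real \<Rightarrow> real" assume \<psi>: "\<psi> \<in> test_functions"
    show "(LBINT x. \<psi> x *\<^sub>R (weak_deriv f x - g x)) = 0"
      using assms w \<psi> test_function_scaleR(1)[OF \<psi> L(1)] test_function_scaleR(1)[OF \<psi> L(2)]
      by (simp add: has_weak_derivative_def scaleR_diff_right)
  qed
  then show ?thesis by simp
qed

section \<open>Increment bounds and uniqueness for linear differential inequalities\<close>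

lemma has_L1_derivative_norm_bound:
  assumes f: "has_L1_derivative f g" and b: "b integrable_on {s..t}" and st: "s \<le> t"
    and le: "AE x in lborel. x \<in> {s..t} \<longrightarrow> norm (g x) \<le> b x" and b0: "\<And>x. b x \<ge> 0"
  shows "norm (f t - f s) \<le> integral {s..t} b"
proof -
  obtain N where N: "negligible N" "\<And>x. x \<notin> N \<Longrightarrow> x \<in> {s..t} \<longrightarrow> norm (g x) \<le> b x"
    using AE_imp_negligible[OF le] by blast
  have i: "((\<lambda>x. if x \<in> N then 0 else g x) has_integral f t - f s) {s..t}"
    by (rule has_integral_spike[OF N(1) _ has_L1_derivative_integral[OF f st]]) auto
  have "norm (integral {s..t} (\<lambda>x. if x \<in> N then 0 else g x)) \<le> integral {s..t} b"
    using N(2) b0 by (intro integral_norm_bound_integral has_integral_integrable[OF i] b) auto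
  then show ?thesis using integral_unique[OF i] by simp
qed

text \<open>The zero set is closed by continuity and shown to be open, so it is the whole line by
  connectedness. Openness is a contraction estimate: near a zero, the maximum of
  \<open>norm (z t)\<close> is at most half of itself. Only local integrability of \<open>k\<close>
  is available, so its primitive \<open>p\<close> measures the length of the interval.\<close>

lemma has_L1_derivative_Gronwall_zero:
  fixes z z' :: "real \<Rightarrow> 'a::euclidean_space"
  assumes z: "has_L1_derivative z z'" and k: "k \<in> L1_loc" "\<And>x. k x \<ge> (0::real)"
    and le: "AE x in lborel. norm (z' x) \<le> k x * norm (z x)" and z0: "z x0 = 0"
  shows "z x = 0"
proof -
  note cz = has_L1_derivative_continuous[OF z]
  obtain p where p: "has_L1_derivative p k" using has_L1_derivative_exists[OF k(1), of 0] by blast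
  have kz: "(\<lambda>x. k x * norm (z x)) \<in> L1_loc"
    using L1_loc_bilinear[OF bounded_bilinear_mult continuous_on_norm[OF cz] k(1)]
    by (simp add: mult.commute)
  have "open {x. z x = 0}"
    unfolding open_dist
  proof
    fix y assume "y \<in> {x. z x = 0}"
    then have zy: "z y = 0" by simp
    obtain d where d: "d > 0" "\<And>t. dist t y \<le> d \<Longrightarrow> dist (p t) (p y) < 1/2"
      using continuous_onE[OF has_L1_derivative_continuous[OF p], of y "1/2"] by auto
    obtain m where m: "m \<in> {y - d..y + d}" "\<And>t. t \<in> {y - d..y + d} \<Longrightarrow> norm (z t) \<le> norm (z m)"
      using continuous_attains_sup[of "{y - d..y + d}" "\<lambda>t. norm (z t)"] d(1)
        continuous_on_subset[OF continuous_on_norm[OF cz]] by auto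
    have *: "norm (z t - z s) \<le> norm (z m) * (p t - p s)"
      if st: "s \<le> t" "s \<in> {y - d..y + d}" "t \<in> {y - d..y + d}" for s t
    proof -
      have "norm (z t - z s) \<le> integral {s..t} (\<lambda>x. k x * norm (z x))"
        using le k(2) by (intro has_L1_derivative_norm_bound[OF z] L1_loc_integrable_on[OF kz] st) auto
      also have "\<dots> \<le> integral {s..t} (\<lambda>x. norm (z m) * k x)"
        using st m(2) k(2) by (intro integral_le L1_loc_integrable_on[OF kz]
            integrable_on_mult_right L1_loc_integrable_on[OF k(1)])
          (auto simp: mult.commute intro!: mult_left_mono)
      also have "\<dots> = norm (z m) * (p t - p s)"
        using integral_unique[OF has_L1_derivative_integral[OF p st(1)]] by simp
      finally show ?thesis .
    qed
    have pm: "\<bar>p m - p y\<bar> < 1/2" using d(2)[of m] m(1) by (auto simp: dist_real_def)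
    have "norm (z m) \<le> norm (z m) * \<bar>p m - p y\<bar>"
    proof (cases "y \<le> m")
      case True
      have "norm (z m) \<le> norm (z m) * (p m - p y)" using *[OF True] m(1) d(1) zy by simp
      then show ?thesis by (smt (verit) mult_left_mono norm_ge_zero)
    next
      case False
      have "norm (z m) \<le> norm (z m) * (p y - p m)" using *[of m y] False m(1) d(1) zy by simp
      then show ?thesis by (smt (verit) mult_left_mono norm_ge_zero)
    qed
    also have "\<dots> \<le> norm (z m) * (1/2)" using pm by (intro mult_left_mono) auto
    finally have "norm (z m) \<le> 0" by simp
    then have "z t = 0" if "dist t y < d" for t
    proof -
      have "t \<in> {y - d..y + d}" using that by (auto simp: dist_real_def)
      from m(2)[OF this] show ?thesis using \<open>norm (z m) \<le> 0\<close> by simp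
    qed
    then show "\<exists>e>0. \<forall>t. dist t y < e \<longrightarrow> t \<in> {x. z x = 0}" using d(1) by auto
  qed
  moreover have "closed {x. z x = 0}" using cz by (intro closed_Collect_eq) auto
  ultimately have "{x. z x = 0} = UNIV" using clopen z0 by (metis (mono_tags) empty_Collect_eq)
  then show ?thesis by auto
qed

section \<open>Weak solutions\<close>

lemma energy_space_has_L1_derivative:
  assumes "u \<in> energy_space" shows "has_L1_derivative u (weak_deriv u)"
proof (rule continuous_weak_derivative_imp_L1_derivative)
  obtain w where "has_weak_derivative u w" using assms by (auto simp: energy_space_def H1_loc_def)
  then show "has_weak_derivative u (weak_deriv u)"
    unfolding weak_deriv_def by (rule someI[of "has_weak_derivative u"])
qed (use assms in \<open>simp add: energy_space_def\<close>)

lemma test_functions_scaleR_const: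
  fixes \<psi> :: "real \<Rightarrow> real" and e :: "'a::euclidean_space"
  assumes "\<psi> \<in> test_functions" shows "(\<lambda>x. \<psi> x *\<^sub>R e) \<in> test_functions"
proof -
  obtain a b where ab: "a < b" "\<And>x. x \<notin> {a<..<b} \<Longrightarrow> \<psi> x = 0"
    "\<And>x. x \<notin> {a<..<b} \<Longrightarrow> vector_derivative \<psi> (at x) = 0"
    using test_functions_support[OF assms] by blast
  show ?thesis
    by (rule test_functionsI[where a=a and b=b, OF smooth_scaleR_const[OF test_function_smooth[OF assms]]])
      (use ab in auto)
qed

section \<open>The flux form of the equation\<close>

definition TW_coeff :: "real \<Rightarrow> (real \<Rightarrow> complex) \<Rightarrow> real \<Rightarrow> real" where
  "TW_coeff \<kappa> u x = 2 * \<kappa> * inner (u x) (weak_deriv u x)"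

definition TW_source :: "real \<Rightarrow> real \<Rightarrow> (real \<Rightarrow> complex) \<Rightarrow> real \<Rightarrow> complex" where
  "TW_source c \<kappa> u x = \<i> * complex_of_real c * weak_deriv u x + (1 - (cmod (u x))\<^sup>2) *\<^sub>R u x
     + TW_coeff \<kappa> u x *\<^sub>R weak_deriv u x"

text \<open>The delicate terms are quadratic in the derivative of \<open>u\<close>. They are
  dominated by a continuous function times its squared norm, which is integrable by finite
  energy.\<close>

lemma TW_L1_loc:
  assumes u: "u \<in> energy_space"
  shows "weak_deriv u \<in> L1_loc"
    and "TW_coeff \<kappa> u \<in> L1_loc"
    and "(\<lambda>x. (TW_coeff \<kappa> u x)\<^sup>2) \<in> L1_loc"
    and "(\<lambda>x. weak_deriv u x - TW_coeff \<kappa> u x *\<^sub>R u x) \<in> L1_loc"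
    and "TW_source c \<kappa> u \<in> L1_loc"
proof -
  let ?w = "weak_deriv u" and ?a = "TW_coeff \<kappa> u"
  have cu: "continuous_on UNIV u" and L2: "?w \<in> L2" using u by (auto simp: energy_space_def)
  show w: "?w \<in> L1_loc" by (rule has_L1_derivative_L1_loc[OF energy_space_has_L1_derivative[OF u]])
  note w2 = L2_norm_sq_L1_loc[OF L2]
  note mw = L1_loc_measurable[OF w]
  have "continuous_on UNIV (\<lambda>x. (2 * \<kappa>) *\<^sub>R u x)" by (intro continuous_intros cu)
  from L1_loc_bilinear[OF bounded_bilinear_inner this w]
  show a: "?a \<in> L1_loc" by (simp add: TW_coeff_def[abs_def])
  note ma = L1_loc_measurable[OF a]
  have a_le: "\<bar>?a x\<bar> \<le> 2 * \<bar>\<kappa>\<bar> * cmod (u x) * cmod (?w x)" for x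
    using mult_left_mono[OF Cauchy_Schwarz_ineq2[of "u x" "?w x"], of "2 * \<bar>\<kappa>\<bar>"]
    by (simp add: TW_coeff_def abs_mult mult.assoc)
  have "(\<lambda>x. (2 * \<bar>\<kappa>\<bar> * cmod (u x))\<^sup>2 * (cmod (?w x))\<^sup>2) \<in> L1_loc"
    by (rule L1_loc_bilinear[OF bounded_bilinear_mult _ w2]) (intro continuous_intros cu)
  then show "(\<lambda>x. (?a x)\<^sup>2) \<in> L1_loc"
  proof (rule L1_loc_bound[rotated])
    show "norm ((?a x)\<^sup>2) \<le> norm ((2 * \<bar>\<kappa>\<bar> * cmod (u x))\<^sup>2 * (cmod (?w x))\<^sup>2)" for x
      using power_mono[OF a_le, of x 2] by (simp add: power_mult_distrib)
  qed (use ma in measurable)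
  show "(\<lambda>x. ?w x - ?a x *\<^sub>R u x) \<in> L1_loc"
    by (intro L1_loc_diff w L1_loc_bilinear[OF bounded_bilinear.flip[OF bounded_bilinear_scaleR] cu a])
  have "(\<lambda>x. 2 * \<bar>\<kappa>\<bar> * cmod (u x) * (cmod (?w x))\<^sup>2) \<in> L1_loc"
    by (rule L1_loc_bilinear[OF bounded_bilinear_mult _ w2]) (intro continuous_intros cu)
  then have "(\<lambda>x. ?a x *\<^sub>R ?w x) \<in> L1_loc"
  proof (rule L1_loc_bound[rotated])
    show "norm (?a x *\<^sub>R ?w x) \<le> norm (2 * \<bar>\<kappa>\<bar> * cmod (u x) * (cmod (?w x))\<^sup>2)" for x
      using mult_right_mono[OF a_le[of x], of "cmod (?w x)"] by (simp add: power2_eq_square mult_ac abs_mult)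
  qed (use ma mw in measurable)
  moreover have "(\<lambda>x. \<i> * complex_of_real c * ?w x) \<in> L1_loc"
    by (rule L1_loc_linear[OF bounded_linear_mult_right w])
  moreover have "(\<lambda>x. (1 - (cmod (u x))\<^sup>2) *\<^sub>R u x) \<in> L1_loc"
    by (intro L1_loc_continuous continuous_intros cu)
  ultimately show "TW_source c \<kappa> u \<in> L1_loc"
    unfolding TW_source_def[abs_def] by (intro L1_loc_add)
qed

text \<open>Expanding the weak derivative of \<open>inner (u t) (\<phi> t)\<close> by the product
  rule splits the quasilinear term: one half is paired with \<open>\<phi>\<close> and joins the
  source, the other is paired with the derivative of \<open>\<phi>\<close> and joins the flux. The
  weak equation then says that minus the source is the weak derivative of the flux.\<close>

lemma weak_solution_TW_flux:
  assumes sol: "weak_solution_TW c \<kappa> u"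
  obtains F where "has_L1_derivative F (\<lambda>x. - TW_source c \<kappa> u x)"
    "AE x in lborel. F x = weak_deriv u x - TW_coeff \<kappa> u x *\<^sub>R u x"
proof -
  have u: "u \<in> energy_space" using sol by (simp add: weak_solution_TW_def)
  let ?w = "weak_deriv u" and ?a = "TW_coeff \<kappa> u"
  note du = energy_space_has_L1_derivative[OF u]
  note cu = has_L1_derivative_continuous[OF du]
  note F0 = TW_L1_loc(4)[OF u, of \<kappa>] and G = TW_L1_loc(5)[OF u, of c \<kappa>]
  let ?F0 = "\<lambda>x. ?w x - ?a x *\<^sub>R u x" and ?G = "TW_source c \<kappa> u"
  have "(LBINT x. vector_derivative \<psi> (at x) *\<^sub>R ?F0 x) = - (LBINT x. \<psi> x *\<^sub>R (- ?G x))"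
    if \<psi>: "\<psi> \<in> test_functions" for \<psi> :: "real \<Rightarrow> real"
  proof -
    note sm = test_function_smooth[OF \<psi>]
    have "inner (LBINT x. vector_derivative \<psi> (at x) *\<^sub>R ?F0 x) e = inner (LBINT x. \<psi> x *\<^sub>R ?G x) e" for e
    proof -
      \<comment> \<open>Complex test functions with a fixed direction \<open>e\<close> give the
        component along \<open>e\<close> of the desired vector identity; letting \<open>e\<close>
        vary gives all of it.\<close>
      define \<phi> where "\<phi> x = \<psi> x *\<^sub>R e" for x
      have \<phi>: "\<phi> \<in> test_functions" unfolding \<phi>_def[abs_def] by (rule test_functions_scaleR_const[OF \<psi>])
      have \<phi>': "vector_derivative \<phi> (at x) = vector_derivative \<psi> (at x) *\<^sub>R e" for x
        unfolding \<phi>_def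
        by (intro vector_derivative_at bounded_linear.has_vector_derivative[OF bounded_linear_scaleR_left]
            smooth_has_derivative sm)
      have d: "has_L1_derivative (\<lambda>t. inner (u t) (\<phi> t))
          (\<lambda>t. inner (?w t) (\<phi> t) + inner (u t) (vector_derivative \<phi> (at t)))"
        by (rule has_L1_derivative_bilinear[OF bounded_bilinear_inner du
              smooth_has_L1_derivative[OF test_function_smooth[OF \<phi>]]])
      note wd = has_L1_derivative_imp_weak[OF d]
      let ?W = "weak_deriv (\<lambda>t. inner (u t) (\<phi> t))"
      have "has_weak_derivative (\<lambda>t. inner (u t) (\<phi> t)) ?W"
        unfolding weak_deriv_def using wd by (rule someI[of "has_weak_derivative _"])
      then have [measurable]: "?W \<in> borel_measurable borel"
        by (auto simp: has_weak_derivative_def L1_loc_measurable)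
      have [measurable]: "u \<in> borel_measurable borel" "?w \<in> borel_measurable borel"
        "\<psi> \<in> borel_measurable borel" "(\<lambda>x. vector_derivative \<psi> (at x)) \<in> borel_measurable borel"
        "\<phi> \<in> borel_measurable borel"
        using cu TW_L1_loc(1)[OF u] smooth_continuous[OF sm] smooth_continuous[OF smooth_derivative[OF sm]]
          smooth_continuous[OF test_function_smooth[OF \<phi>]]
        by (auto intro: borel_measurable_continuous_onI L1_loc_measurable)
      have [measurable]: "?F0 \<in> borel_measurable borel" "?G \<in> borel_measurable borel"
        using F0 G by (auto intro: L1_loc_measurable)
      have "0 = (LBINT x.
          inner (\<i> * complex_of_real c * ?w x + u x * complex_of_real (1 - (cmod (u x))\<^sup>2)) (\<phi> x)
          - inner (?w x) (vector_derivative \<phi> (at x)) + 2 * \<kappa> * inner (u x) (?w x) * ?W x)"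
        using sol \<phi> by (simp add: weak_solution_TW_def)
      \<comment> \<open>The chosen weak derivative \<open>?W\<close> agrees with the product rule
        only almost everywhere, which suffices under the integral.\<close>
      also have "\<dots> = (LBINT x. inner (\<psi> x *\<^sub>R ?G x) e - inner (vector_derivative \<psi> (at x) *\<^sub>R ?F0 x) e)"
      proof (rule integral_cong_AE)
        show "AE x in lborel.
          inner (\<i> * complex_of_real c * ?w x + u x * complex_of_real (1 - (cmod (u x))\<^sup>2)) (\<phi> x)
          - inner (?w x) (vector_derivative \<phi> (at x)) + 2 * \<kappa> * inner (u x) (?w x) * ?W x
          = inner (\<psi> x *\<^sub>R ?G x) e - inner (vector_derivative \<psi> (at x) *\<^sub>R ?F0 x) e"
          using weak_deriv_AE_eq[OF wd]
        proof eventually_elim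
          case (elim x)
          have "u x * complex_of_real (1 - (cmod (u x))\<^sup>2) = (1 - (cmod (u x))\<^sup>2) *\<^sub>R u x"
            by (simp only: scaleR_conv_of_real mult.commute)
          then show ?case
            unfolding elim \<phi>' unfolding \<phi>_def TW_source_def TW_coeff_def
            by (simp only: inner_add_left inner_diff_left inner_scaleR_left inner_scaleR_right)
              (simp only: algebra_simps)
        qed
      qed (simp_all only: \<phi>', measurable)
      also have "\<dots> = inner (LBINT x. \<psi> x *\<^sub>R ?G x) e - inner (LBINT x. vector_derivative \<psi> (at x) *\<^sub>R ?F0 x) e"
        using test_function_scaleR(1)[OF \<psi> G] test_function_scaleR(2)[OF \<psi> F0]
        by (subst Bochner_Integration.integral_diff) (auto simp del: inner_scaleR_left)
      finally show ?thesis by simp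
    qed
    then have "(LBINT x. vector_derivative \<psi> (at x) *\<^sub>R ?F0 x) = (LBINT x. \<psi> x *\<^sub>R ?G x)"
      by (metis vector_eq_rdot)
    then show ?thesis by simp
  qed
  then have "has_weak_derivative ?F0 (\<lambda>x. - ?G x)"
    using F0 L1_loc_minus[OF G] by (simp add: has_weak_derivative_def)
  then obtain F where "has_L1_derivative F (\<lambda>x. - ?G x)" "AE x in lborel. ?F0 x = F x"
    by (rule has_weak_derivative_imp_L1_derivative)
  then show thesis by (intro that[of F]) auto
qed

section \<open>The momentum identity\<close>

lemma inner_i_mult_self: "inner z (\<i> * z) = 0" "inner (\<i> * z) z = 0" for z :: complex
  by (simp_all add: inner_complex_def)

lemma not_integrable_const_lborel:
  assumes "integrable lborel (\<lambda>x::real. K::real)" shows "K = 0"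
  using assms by (auto simp: integrable_iff_bounded ennreal_mult_top split: if_splits)

text \<open>The continuous flux satisfies the identity at every point, which supplies an initial
  value when \<open>c = 0\<close>; the derivative of \<open>u\<close> satisfies it almost
  everywhere, which suffices for the energy estimate when \<open>c > 0\<close>. The two pairings
  agree because \<open>u\<close> is orthogonal to \<open>\<i> * u\<close>.\<close>

lemma weak_solution_TW_momentum:
  assumes sol: "weak_solution_TW c \<kappa> u"
    and F: "has_L1_derivative F (\<lambda>x. - TW_source c \<kappa> u x)"
    and F_eq: "AE x in lborel. F x = weak_deriv u x - TW_coeff \<kappa> u x *\<^sub>R u x"
  shows "inner (F x) (\<i> * u x) = c / 2 * (1 - (cmod (u x))\<^sup>2)"
    and "AE x in lborel. inner (weak_deriv u x) (\<i> * u x) = c / 2 * (1 - (cmod (u x))\<^sup>2)"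
proof -
  have u: "u \<in> energy_space" using sol by (simp add: weak_solution_TW_def)
  let ?w = "weak_deriv u" and ?a = "TW_coeff \<kappa> u" and ?\<eta> = "\<lambda>x. 1 - (cmod (u x))\<^sup>2"
  note du = energy_space_has_L1_derivative[OF u]
  \<comment> \<open>The conserved quantity: the term \<open>\<i> c w\<close> of the source is
    compensated by the derivative of \<open>(c / 2) \<bar>u\<bar>^2\<close>, and the two terms
    containing \<open>TW_coeff\<close> cancel by antisymmetry.\<close>
  define Q where "Q x = inner (F x) (\<i> * u x) + (c / 2) * inner (u x) (u x)" for x
  have dQ: "has_L1_derivative Q (\<lambda>x. (inner (- TW_source c \<kappa> u x) (\<i> * u x) + inner (F x) (\<i> * ?w x))
      + (c / 2) * (inner (?w x) (u x) + inner (u x) (?w x)))"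
    unfolding Q_def[abs_def]
    by (intro has_L1_derivative_add has_L1_derivative_linear[OF bounded_linear_mult_right]
        has_L1_derivative_bilinear[OF bounded_bilinear_inner] du F)
  have "AE x in lborel. (inner (- TW_source c \<kappa> u x) (\<i> * u x) + inner (F x) (\<i> * ?w x))
      + (c / 2) * (inner (?w x) (u x) + inner (u x) (?w x)) = 0"
    using F_eq
  proof eventually_elim
    case (elim x)
    show ?case unfolding elim TW_source_def
      by (simp add: inner_complex_def algebra_simps)
  qed
  then have Qc: "Q x = Q 0" for x by (rule has_L1_derivative_zero_imp_const[OF dQ])
  define K where "K = Q 0 - c / 2"
  have FK: "inner (F x) (\<i> * u x) = c / 2 * ?\<eta> x + K" for x
    using Qc[of x] by (simp add: Q_def[of x] K_def dot_square_norm algebra_simps)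
  have wK: "AE x in lborel. inner (?w x) (\<i> * u x) = c / 2 * ?\<eta> x + K"
    using F_eq
  proof eventually_elim
    case (elim x)
    have "inner (F x) (\<i> * u x) = inner (?w x) (\<i> * u x)"
      unfolding elim by (simp add: inner_diff_left inner_i_mult_self)
    then show ?case using FK[of x] by simp
  qed
  have "K = 0"
  proof (rule ccontr)
    assume "K \<noteq> 0"
    \<comment> \<open>Young's inequality is used twice and leaves \<open>\<delta>\<close> each time;
      together they consume half of \<open>\<bar>K\<bar>\<close>, and the other half would be
      dominated by the integrable \<open>g\<close>.\<close>
    define \<delta> where "\<delta> = \<bar>K\<bar> / 4"
    have \<delta>: "\<delta> > 0" using \<open>K \<noteq> 0\<close> by (simp add: \<delta>_def)
    have i1: "integrable lborel (\<lambda>x. (cmod (?w x))\<^sup>2)" and i2: "integrable lborel (\<lambda>x. (?\<eta> x)\<^sup>2)"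
      using u by (auto simp: energy_space_def L2_def)
    \<comment> \<open>The coefficients collect \<open>am\<close> for \<open>cmod (?w x)\<close> and
      for \<open>c / 2 * ?\<eta> x\<close>, together with the arithmetic-geometric mean bound for
      \<open>cmod (?w x) * \<bar>?\<eta> x\<bar>\<close>.\<close>
    define g where "g x = (1 / (4 * \<delta>) + 1/2) * (cmod (?w x))\<^sup>2 + (1/2 + c\<^sup>2 / (16 * \<delta>)) * (?\<eta> x)\<^sup>2" for x
    have am: "\<bar>s\<bar> \<le> \<delta> + s\<^sup>2 / (4 * \<delta>)" for s
    proof -
      have "0 \<le> (\<bar>s\<bar> - 2 * \<delta>)\<^sup>2" by simp
      then have "4 * \<delta> * \<bar>s\<bar> \<le> 4 * \<delta>\<^sup>2 + s\<^sup>2" by (simp add: power2_diff algebra_simps)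
      then have "\<bar>s\<bar> \<le> (4 * \<delta>\<^sup>2 + s\<^sup>2) / (4 * \<delta>)" using \<delta> by (simp add: field_simps)
      also have "\<dots> = \<delta> + s\<^sup>2 / (4 * \<delta>)" using \<delta> by (simp add: field_simps power2_eq_square)
      finally show ?thesis .
    qed
    have ae: "AE x in lborel. norm (\<bar>K\<bar> / 2) \<le> norm (g x)"
      using wK
    proof eventually_elim
      case (elim x)
      have *: "\<bar>inner (?w x) (\<i> * u x)\<bar> \<le> cmod (?w x) * cmod (u x)"
        using Cauchy_Schwarz_ineq2[of "?w x" "\<i> * u x"] by (simp add: norm_mult)
      have "cmod (u x) \<le> 1 + \<bar>?\<eta> x\<bar>"
      proof (cases "cmod (u x) \<le> 1")
        case False
        then have "cmod (u x) \<le> (cmod (u x))\<^sup>2" by (intro self_le_power) auto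
        then show ?thesis by linarith
      qed simp
      then have "cmod (?w x) * cmod (u x) \<le> cmod (?w x) * (1 + \<bar>?\<eta> x\<bar>)"
        by (intro mult_left_mono) auto
      moreover have "cmod (?w x) * \<bar>?\<eta> x\<bar> \<le> ((cmod (?w x))\<^sup>2 + (?\<eta> x)\<^sup>2) / 2"
        using sum_squares_bound[of "cmod (?w x)" "\<bar>?\<eta> x\<bar>"] by (simp add: mult.assoc)
      moreover have "\<bar>c / 2 * ?\<eta> x\<bar> \<le> \<delta> + c\<^sup>2 / (16 * \<delta>) * (?\<eta> x)\<^sup>2"
        using am[of "c / 2 * ?\<eta> x"] by (simp add: power_mult_distrib power_divide)
      ultimately have "\<bar>K\<bar> \<le> (\<delta> + (cmod (?w x))\<^sup>2 / (4 * \<delta>)) + ((cmod (?w x))\<^sup>2 + (?\<eta> x)\<^sup>2) / 2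
          + (\<delta> + c\<^sup>2 / (16 * \<delta>) * (?\<eta> x)\<^sup>2)"
        using * elim am[of "cmod (?w x)"] unfolding distrib_left by linarith
      also have "\<dots> = 2 * \<delta> + g x"
        by (simp add: g_def algebra_simps add_divide_distrib)
      finally have "\<bar>K\<bar> \<le> 2 * \<delta> + g x" .
      then show ?case by (simp add: \<delta>_def)
    qed
    have gi: "integrable lborel g" unfolding g_def
      by (rule Bochner_Integration.integrable_add[OF integrable_mult_right[OF i1] integrable_mult_right[OF i2]])
    have "integrable lborel (\<lambda>x::real. \<bar>K\<bar> / 2)"
      by (rule Bochner_Integration.integrable_bound[OF gi _ ae]) simp
    then have "\<bar>K\<bar> / 2 = 0" by (rule not_integrable_const_lborel)
    then show False using \<open>K \<noteq> 0\<close> by simp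
  qed
  then show "inner (F x) (\<i> * u x) = c / 2 * ?\<eta> x"
    and "AE x in lborel. inner (?w x) (\<i> * u x) = c / 2 * ?\<eta> x"
    using FK wK by auto
qed

section \<open>Energy estimates for positive speed\<close>

lemma integrable_lborel_Icc:
  fixes f :: "real \<Rightarrow> real"
  assumes f: "integrable lborel f" "\<And>x. f x \<ge> 0"
  shows "f integrable_on {a..b}" "integral {a..b} f \<le> (LBINT x. f x)"
proof -
  have i: "integrable lborel (\<lambda>x. indicator {a..b} x *\<^sub>R f x)"
    by (rule integrable_mult_indicator[OF _ f(1)]) simp
  then have s: "set_integrable lborel {a..b} f" by (simp add: set_integrable_def)
  show "f integrable_on {a..b}" by (rule set_borel_integral_eq_integral(1)[OF s])
  have "integral {a..b} f = (LBINT x. indicator {a..b} x *\<^sub>R f x)"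
    using set_borel_integral_eq_integral(2)[OF s] by (simp add: set_lebesgue_integral_def)
  also have "\<dots> \<le> (LBINT x. f x)"
    by (rule integral_mono[OF i f(1)]) (use f(2) in \<open>simp add: indicator_def\<close>)
  finally show "integral {a..b} f \<le> (LBINT x. f x)" .
qed

text \<open>This is the Cauchy-Schwarz inequality for the integral of \<open>norm (w t)\<close>,
  obtained by integrating a pointwise Young inequality with an optimised parameter.\<close>

lemma has_L1_derivative_Hoelder:
  assumes u: "has_L1_derivative u w" and i: "integrable lborel (\<lambda>x. (norm (w x))\<^sup>2)"
    and L: "(LBINT x. (norm (w x))\<^sup>2) \<le> L" "L > 0" and xy: "x \<le> y"
  shows "norm (u y - u x) \<le> sqrt (L * (y - x))"
proof (cases "x = y")
  case False
  define d where "d = y - x"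
  have d: "d > 0" using False xy by (simp add: d_def)
  define s where "s = sqrt (L * d)"
  have s: "s > 0" "s\<^sup>2 = L * d" using d L(2) by (auto simp: s_def)
  \<comment> \<open>The optimal parameter \<open>sqrt (d / L)\<close>: it makes both halves of the
    integrated Young bound equal to \<open>s / 2\<close>.\<close>
  define l where "l = s / L"
  have l: "l > 0" "l * L = s" "d / l = s"
    using d L(2) s by (auto simp: l_def field_simps power2_eq_square)
  define b where "b t = l / 2 * (norm (w t))\<^sup>2 + 1 / (2 * l)" for t
  note w2 = integrable_lborel_Icc[OF i, of x y, simplified]
  have bi: "(b has_integral (l / 2 * integral {x..y} (\<lambda>t. (norm (w t))\<^sup>2) + d * (1 / (2 * l)))) {x..y}"
    unfolding b_def
    using has_integral_add[OF has_integral_mult_right[OF integrable_integral[OF w2(1)], of "l / 2"]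
        has_integral_const_real[of "1 / (2 * l)" x y]] xy by (simp add: d_def)
  have "norm (u y - u x) \<le> integral {x..y} b"
  proof (rule has_L1_derivative_norm_bound[OF u has_integral_integrable[OF bi] xy])
    have "norm (w t) \<le> b t" for t
    proof -
      have "0 \<le> (l * norm (w t) - 1)\<^sup>2" by simp
      then show ?thesis using l(1) by (simp add: b_def power2_eq_square field_simps)
    qed
    then show "AE t in lborel. t \<in> {x..y} \<longrightarrow> norm (w t) \<le> b t" by simp
    show "b t \<ge> 0" for t using l(1) by (simp add: b_def)
  qed
  also have "\<dots> = l / 2 * integral {x..y} (\<lambda>t. (norm (w t))\<^sup>2) + d / l / 2"
    using integral_unique[OF bi] by simp
  also have "\<dots> \<le> l / 2 * L + d / l / 2" using w2(2) L(1) l(1) by (intro add_right_mono mult_left_mono) auto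
  also have "\<dots> = s" using l(2,3) by simp
  finally show ?thesis by (simp add: s_def d_def)
qed simp

text \<open>Near a point where \<open>\<bar>u\<bar>\<close> is small the momentum identity forces \<open>\<bar>w\<bar> \<ge> 3c / (8\<bar>u\<bar>)\<close>, while
  \<open>\<bar>u\<bar>\<close> grows at most like a square root; hence the energy of \<open>w\<close> is at least of the order of
  \<open>- ln \<bar>u\<bar>\<close> at that point.\<close>

lemma momentum_imp_lower_bound:
  fixes u w :: "real \<Rightarrow> complex"
  assumes u: "has_L1_derivative u w" and i: "integrable lborel (\<lambda>x. (cmod (w x))\<^sup>2)"
    and mom: "AE x in lborel. inner (w x) (\<i> * u x) = c / 2 * (1 - (cmod (u x))\<^sup>2)"
    and c: "c > 0"
  obtains m where "m > 0" "\<And>x. m \<le> cmod (u x)"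
proof -
  \<comment> \<open>Adding 1 makes the energy bound strictly positive, so that it can be divided
    by.\<close>
  define L where "L = (LBINT x. (cmod (w x))\<^sup>2) + 1"
  have "(LBINT x. (cmod (w x))\<^sup>2) \<ge> 0" by (rule Bochner_Integration.integral_nonneg) simp
  then have L: "(LBINT x. (cmod (w x))\<^sup>2) \<le> L" "L > 0" unfolding L_def by linarith+
  \<comment> \<open>Where \<open>cmod (u x) \<le> 1/2\<close>, the right side of the momentum
    identity is at least \<open>3/4 * (c / 2)\<close>.\<close>
  define A where "A = (3 * c / 8)\<^sup>2"
  have A: "A > 0" using c by (simp add: A_def)
  define B where "B = 2 * L\<^sup>2 / A"
  \<comment> \<open>Over a distance \<open>r\<close> the Hoelder bound allows growth by at most
    \<open>1/4\<close>; starting from at most \<open>1/4\<close>, the modulus of \<open>u\<close>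
    stays below or at \<open>1/2\<close>.\<close>
  define r where "r = 1 / (16 * L)"
  have r: "r > 0" "L * r = 1 / 16" using L(2) by (auto simp: r_def)
  \<comment> \<open>The positive bound \<open>\<delta>\<close> replaces \<open>cmod (u x0)\<close>,
    which might be zero. The energy on \<open>{x0..x0 + r}\<close> is at least
    \<open>A / (2 * L)\<close> times a logarithmic increment and at most \<open>L\<close>, so the
    increment is at most \<open>B\<close>.\<close>
  have key: "exp (- B) \<le> 16 * \<delta>\<^sup>2" if \<delta>: "0 < \<delta>" "\<delta> \<le> 1/4" "cmod (u x0) \<le> \<delta>" for \<delta> x0
  proof -
    \<comment> \<open>The denominator bounds \<open>(\<delta> + sqrt (L * (x - x0)))^2\<close>,
      hence \<open>(cmod (u x))^2\<close>, from above and has the elementary primitive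
      \<open>G\<close>.\<close>
    define g where "g x = A / (2 * \<delta>\<^sup>2 + 2 * L * (x - x0))" for x
    define G where "G x = A / (2 * L) * ln (2 * \<delta>\<^sup>2 + 2 * L * (x - x0))" for x
    have pos: "2 * \<delta>\<^sup>2 + 2 * L * (x - x0) > 0" if "x \<ge> x0" for x
      using \<delta>(1) L(2) that by (intro add_pos_nonneg) auto
    have gi: "(g has_integral G (x0 + r) - G x0) {x0..x0 + r}"
    proof (rule fundamental_theorem_of_calculus)
      fix x assume "x \<in> {x0..x0 + r}"
      then have "(G has_real_derivative g x) (at x)"
        unfolding G_def g_def using pos[of x] L(2) by (auto intro!: derivative_eq_intros)
      then show "(G has_vector_derivative g x) (at x within {x0..x0 + r})"
        by (simp add: has_real_derivative_iff_has_vector_derivative has_vector_derivative_at_within)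
    qed (use r(1) in simp)
    have "AE x in lborel. x \<in> {x0..x0 + r} \<longrightarrow> g x \<le> (cmod (w x))\<^sup>2"
      using mom
    proof eventually_elim
      case (elim x)
      show ?case
      proof
        assume x: "x \<in> {x0..x0 + r}"
        define t where "t = L * (x - x0)"
        have "t \<le> L * r" unfolding t_def using x L(2) by (intro mult_left_mono) auto
        then have t: "0 \<le> t" "t \<le> 1 / 16" using x L(2) r(2) by (auto simp: t_def)
        have "cmod (u x) \<le> cmod (u x0) + cmod (u x - u x0)" by (metis add.commute diff_add_cancel norm_triangle_ineq)
        also have "\<dots> \<le> \<delta> + sqrt t"
          using \<delta>(3) has_L1_derivative_Hoelder[OF u i L, of x0 x] x by (simp add: t_def)
        finally have le: "cmod (u x) \<le> \<delta> + sqrt t" .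
        have "sqrt t \<le> sqrt ((1/4)\<^sup>2)" using t(2) by (intro real_sqrt_le_mono) (simp add: power2_eq_square)
        then have half: "cmod (u x) \<le> 1/2" using le \<delta>(2) by simp
        have "(cmod (u x))\<^sup>2 \<le> (1/2)\<^sup>2" using half by (intro power_mono) auto
        then have "3 / 4 * (c / 2) \<le> (1 - (cmod (u x))\<^sup>2) * (c / 2)"
          using c by (intro mult_right_mono) (auto simp: power2_eq_square)
        also have "\<dots> \<le> cmod (w x) * cmod (u x)"
          using elim Cauchy_Schwarz_ineq2[of "w x" "\<i> * u x"] by (simp add: norm_mult mult.commute)
        finally have "(3 * c / 8)\<^sup>2 \<le> (cmod (w x) * cmod (u x))\<^sup>2"
          using c by (intro power_mono) auto
        also have "\<dots> = (cmod (w x))\<^sup>2 * (cmod (u x))\<^sup>2" by (simp add: power_mult_distrib)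
        also have "(cmod (u x))\<^sup>2 \<le> (\<delta> + sqrt t)\<^sup>2" using le by (intro power_mono) auto
        also have "\<dots> \<le> 2 * \<delta>\<^sup>2 + 2 * t"
          using t(1) sum_squares_bound[of \<delta> "sqrt t"] by (simp add: power2_sum)
        finally have "A \<le> (cmod (w x))\<^sup>2 * (2 * \<delta>\<^sup>2 + 2 * t)"
          by (simp add: A_def mult_left_mono)
        then show "g x \<le> (cmod (w x))\<^sup>2"
          using pos[of x] x by (simp add: g_def t_def divide_le_eq mult.assoc)
      qed
    qed
    then obtain N where N: "negligible N"
      "\<And>x. x \<notin> N \<Longrightarrow> x \<in> {x0..x0 + r} \<longrightarrow> g x \<le> (cmod (w x))\<^sup>2"
      using AE_imp_negligible by blast
    note w2 = integrable_lborel_Icc[OF i, of x0 "x0 + r", simplified]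
    have "((\<lambda>x. if x \<in> N then 0 else g x) has_integral G (x0 + r) - G x0) {x0..x0 + r}"
      by (rule has_integral_spike[OF N(1) _ gi]) auto
    then have "G (x0 + r) - G x0 \<le> integral {x0..x0 + r} (\<lambda>x. (cmod (w x))\<^sup>2)"
      by (rule has_integral_le[OF _ integrable_integral[OF w2(1)]]) (use N(2) in auto)
    also have "\<dots> \<le> L" using w2(2) L(1) by simp
    finally have "A / (2 * L) * (ln (2 * \<delta>\<^sup>2 + 2 * L * r) - ln (2 * \<delta>\<^sup>2)) \<le> L"
      by (simp add: G_def right_diff_distrib)
    then have "ln (2 * \<delta>\<^sup>2 + 2 * L * r) - ln (2 * \<delta>\<^sup>2) \<le> B"
      using A L(2) by (simp add: B_def field_simps power2_eq_square)
    moreover have "ln (1 / 8) \<le> ln (2 * \<delta>\<^sup>2 + 2 * L * r)"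
    proof (rule ln_mono)
      show "1 / 8 \<le> 2 * \<delta>\<^sup>2 + 2 * L * r" using r(2) zero_le_power2[of \<delta>] mult.assoc[of 2 L r] by linarith
    qed simp_all
    ultimately have "ln (1 / 8) - B \<le> ln (2 * \<delta>\<^sup>2)" by simp
    then have "exp (ln (1 / 8) - B) \<le> exp (ln (2 * \<delta>\<^sup>2))" by simp
    then show ?thesis using \<delta>(1) by (simp add: exp_diff exp_minus field_simps)
  qed
  \<comment> \<open>The first entry makes \<open>key\<close> applicable; the second gives
    \<open>16 * m^2 \<le> exp (- B) / 4\<close>, so a value of modulus at most \<open>m\<close>
    would contradict \<open>key\<close>.\<close>
  define m where "m = min (1/4) (exp (- B / 2) / 8)"
  have m: "0 < m" "m \<le> 1/4" "m \<le> exp (- B / 2) / 8" by (auto simp: m_def)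
  have "16 * m\<^sup>2 < exp (- B)"
  proof -
    have "m\<^sup>2 \<le> (exp (- B / 2) / 8)\<^sup>2" using m by (intro power_mono) auto
    also have "\<dots> = exp (- B) / 64" by (simp add: power_divide flip: exp_double)
    finally show ?thesis by (simp add: less_le_trans) (smt (verit) exp_gt_zero)
  qed
  then have "m \<le> cmod (u x)" for x using key[OF m(1,2), of x] by force
  then show thesis using m(1) that by blast
qed

text \<open>When \<open>u x1\<close> is nonzero, orthogonality to \<open>\<i> * u x1\<close> places
  every value of \<open>u\<close> on the real line through 0 and \<open>u x1\<close>, which is the
  constancy of phase sought for \<open>c = 0\<close>.\<close>

lemma weak_solution_TW_rest_parallel:
  assumes sol: "weak_solution_TW 0 \<kappa> u"
  shows "inner (u x) (\<i> * u x1) = 0"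
proof -
  have u: "u \<in> energy_space" using sol by (simp add: weak_solution_TW_def)
  let ?w = "weak_deriv u" and ?a = "TW_coeff \<kappa> u" and ?\<eta> = "\<lambda>x. 1 - (cmod (u x))\<^sup>2"
  note du = energy_space_has_L1_derivative[OF u]
  note cu = has_L1_derivative_continuous[OF du]
  obtain F where F: "has_L1_derivative F (\<lambda>x. - TW_source 0 \<kappa> u x)"
    and F_eq: "AE x in lborel. F x = ?w x - ?a x *\<^sub>R u x"
    using weak_solution_TW_flux[OF sol] by blast
  define n where "n = \<i> * u x1"
  \<comment> \<open>The two real unknowns of the linear system are packed into one complex function,
    to which the Gronwall lemma applies.\<close>
  define z where "z x = complex_of_real (inner (u x) n) + \<i> * complex_of_real (inner (F x) n)" for x
  define z' where "z' x = complex_of_real (inner (?w x) n) + \<i> * complex_of_real (inner (- TW_source 0 \<kappa> u x) n)" for x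
  have z: "has_L1_derivative z z'"
    unfolding z_def[abs_def] z'_def[abs_def]
    by (intro has_L1_derivative_add has_L1_derivative_linear[OF bounded_linear_of_real]
        has_L1_derivative_linear[OF bounded_linear_mult_right]
        has_L1_derivative_linear[OF bounded_linear_inner_left] du F)
  \<comment> \<open>The square of \<open>?a x\<close> arises on replacing the derivative of
    \<open>u\<close> by the flux in the source; the factor 2 bounds the sum of the two components by
    \<open>2 * cmod (z x)\<close>.\<close>
  define k where "k x = 2 * (1 + \<bar>?\<eta> x\<bar> + \<bar>?a x\<bar> + (?a x)\<^sup>2)" for x
  have k: "k \<in> L1_loc"
    unfolding k_def[abs_def]
    using L1_loc_norm[OF TW_L1_loc(2)[OF u, of \<kappa>]]
    by (intro L1_loc_linear[OF bounded_linear_mult_right] L1_loc_add TW_L1_loc(3)[OF u])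
      (auto intro!: L1_loc_continuous continuous_intros cu)
  have z_le: "\<bar>inner (u x) n\<bar> \<le> cmod (z x)" "\<bar>inner (F x) n\<bar> \<le> cmod (z x)" for x
    using abs_Re_le_cmod[of "z x"] abs_Im_le_cmod[of "z x"] by (auto simp: z_def)
  have "AE x in lborel. cmod (z' x) \<le> k x * cmod (z x)"
    using F_eq
  proof eventually_elim
    case (elim x)
    let ?v = "inner (u x) n" and ?f = "inner (F x) n"
    have w: "inner (?w x) n = ?f + ?a x * ?v" using elim by (simp add: inner_diff_left)
    have s: "inner (- TW_source 0 \<kappa> u x) n = - (?\<eta> x * ?v + ?a x * ?f + (?a x)\<^sup>2 * ?v)"
      unfolding TW_source_def
      by (simp add: inner_add_left) (simp add: w power2_eq_square algebra_simps)
    have "cmod (z' x) \<le> \<bar>inner (?w x) n\<bar> + \<bar>inner (- TW_source 0 \<kappa> u x) n\<bar>"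
      unfolding z'_def
      by (rule norm_triangle_le) (simp only: norm_mult norm_ii mult_1 norm_of_real)
    also have "\<dots> \<le> (\<bar>?f\<bar> + \<bar>?a x\<bar> * \<bar>?v\<bar>) + (\<bar>?\<eta> x\<bar> * \<bar>?v\<bar> + \<bar>?a x\<bar> * \<bar>?f\<bar> + (?a x)\<^sup>2 * \<bar>?v\<bar>)"
    proof (rule add_mono)
      show "\<bar>inner (?w x) n\<bar> \<le> \<bar>?f\<bar> + \<bar>?a x\<bar> * \<bar>?v\<bar>"
        unfolding w using abs_triangle_ineq[of ?f "?a x * ?v"] by (simp add: abs_mult)
      show "\<bar>inner (- TW_source 0 \<kappa> u x) n\<bar> \<le> \<bar>?\<eta> x\<bar> * \<bar>?v\<bar> + \<bar>?a x\<bar> * \<bar>?f\<bar> + (?a x)\<^sup>2 * \<bar>?v\<bar>"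
        unfolding s abs_minus_cancel
        using abs_triangle_ineq[of "?\<eta> x * ?v + ?a x * ?f" "(?a x)\<^sup>2 * ?v"]
          abs_triangle_ineq[of "?\<eta> x * ?v" "?a x * ?f"] by (simp add: abs_mult)
    qed
    also have "\<dots> \<le> (1 + \<bar>?\<eta> x\<bar> + \<bar>?a x\<bar> + (?a x)\<^sup>2) * (\<bar>?v\<bar> + \<bar>?f\<bar>)"
      by (simp add: algebra_simps)
    also have "\<dots> \<le> (1 + \<bar>?\<eta> x\<bar> + \<bar>?a x\<bar> + (?a x)\<^sup>2) * (2 * cmod (z x))"
      using z_le[of x] by (intro mult_left_mono) auto
    finally show ?case by (simp only: k_def mult_ac)
  qed
  note z'_le = this
  \<comment> \<open>The real part vanishes because \<open>u x1\<close> is orthogonal to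
    \<open>\<i> * u x1\<close>, the imaginary part by the pointwise momentum identity with
    \<open>c = 0\<close>.\<close>
  have "z x1 = 0"
    using weak_solution_TW_momentum(1)[OF sol F F_eq, of x1]
    by (simp add: z_def n_def inner_i_mult_self)
  then have "z x = 0"
    by (rule has_L1_derivative_Gronwall_zero[OF z k _ z'_le, rotated]) (simp add: k_def)
  then show ?thesis using z_le(1)[of x] by (simp add: n_def)
qed

theorem proposition1p6:
  fixes c \<kappa> :: real and u :: "real \<Rightarrow> complex"
  assumes "(c, \<kappa>) \<in> D_tilde_set \<union> C_set"
    and "u \<in> energy_space"
    and "weak_solution_TW c \<kappa> u"
  shows "(c > 0 \<longrightarrow> u \<in> nonvanishing_energy_space) \<and>
         (c = 0 \<longrightarrow> (\<exists>\<phi>::real. \<forall>x. exp (\<i> * complex_of_real \<phi>) * u x \<in> \<real>))"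
proof (intro conjI impI)
  assume c: "c > 0"
  obtain F where F: "has_L1_derivative F (\<lambda>x. - TW_source c \<kappa> u x)"
    "AE x in lborel. F x = weak_deriv u x - TW_coeff \<kappa> u x *\<^sub>R u x"
    using weak_solution_TW_flux[OF assms(3)] by blast
  have "integrable lborel (\<lambda>x. (cmod (weak_deriv u x))\<^sup>2)"
    using assms(2) by (simp add: energy_space_def L2_def)
  then obtain m where m: "m > 0" "\<And>x. m \<le> cmod (u x)"
    using momentum_imp_lower_bound[OF energy_space_has_L1_derivative[OF assms(2)] _
        weak_solution_TW_momentum(2)[OF assms(3) F] c] by blast
  have "m \<le> (INF x. cmod (u x))" by (rule cINF_greatest) (use m(2) in auto)
  then show "u \<in> nonvanishing_energy_space"
    using m(1) assms(2) by (simp add: nonvanishing_energy_space_def)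
next
  assume "c = 0"
  show "\<exists>\<phi>::real. \<forall>x. exp (\<i> * complex_of_real \<phi>) * u x \<in> \<real>"
  proof (cases "\<exists>x1. u x1 \<noteq> 0")
    case True
    then obtain x1 where x1: "u x1 \<noteq> 0" by blast
    \<comment> \<open>Rotating by minus the argument of one nonzero value turns the common line of
      all values into the real axis. If \<open>u\<close> had no nonzero value, any phase would
      do.\<close>
    have "exp (\<i> * complex_of_real (- Arg (u x1))) * u x \<in> \<real>" for x
    proof -
      have "exp (\<i> * complex_of_real (- Arg (u x1))) = cnj (sgn (u x1))"
        using cis_Arg[OF x1] by (simp add: cis_conv_exp flip: cis_cnj) (metis cis_cnj cis_conv_exp of_real_minus mult_minus_right)
      moreover have "Im (cnj (u x1) * u x) = 0"
        using weak_solution_TW_rest_parallel[of \<kappa> u x x1] assms(3) \<open>c = 0\<close>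
        by (simp add: inner_complex_def algebra_simps)
      then have "Im (cnj (sgn (u x1)) * u x) = 0" by (simp add: sgn_div_norm scaleR_conv_of_real)
      ultimately show ?thesis by (simp add: complex_is_Real_iff)
    qed
    then show ?thesis by blast
  qed simp
qed

end
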